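(* For every $n\ge5$ there exist convex symmetric bodies $K,L\subset\mathbb{R}^n$ and a log-concave measure $\mu$ on $\mathbb{R}^n$ with density $e^{-\phi(\|x\|_L)}$, where $\phi:[0,\infty)\to[0,\infty)$ is a non-constant increasing convex function, such that $$\mu(rK\cap\xi^\perp)\le\mu(rL\cap\xi^\perp)\quad\text{for all }\xi\in\mathbb{S}^{n-1}\text{ and all }r>0,$$ but $\mu(K)>\mu(L)$.
   Context: A convex body is a convex compact set with nonempty interior; it is symmetric if $K=-K$. The Minkowski functional of $L$ is $\|x\|_L=\min\{\lambda>0:x\in\lambda L\}$ for $x\ne0$, with $\|0\|_L=0$. $\mathbb{S}^{n-1}$ is the Euclidean unit sphere and $\xi^\perp$ is the hyperplane through the origin orthogonal to $\xi$. For a measure $\mu$ on $\mathbb{R}^n$ with density $f$ and a body $A$, $\mu(A)=\int_A f(x)\,dx$, and the measure of a section is $\mu(A\cap\xi^\perp)=\int_{A\cap\xi^\perp}f(x)\,dx$, where the integral is with respect to $(n-1)$-dimensional Lebesgue measure on $\xi^\perp$. For $r>0$, $rA=\{ra:a\in A\}$. "Increasing" is understood as non-decreasing. *)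

theory Defs
  imports "HOL-Analysis.Analysis"
begin

definition convex_body :: "'a::euclidean_space set \<Rightarrow> bool" where
  "convex_body K \<longleftrightarrow> convex K \<and> compact K \<and> interior K \<noteq> {}"

definition symmetric_set :: "'a::real_vector set \<Rightarrow> bool" where
  "symmetric_set K \<longleftrightarrow> K = uminus ` K"

definition minkowski_functional :: "'a::real_vector set \<Rightarrow> 'a \<Rightarrow> real" where
  "minkowski_functional L x =
     (if x = 0 then 0 else (LEAST t. 0 < t \<and> x \<in> (*\<^sub>R) t ` L))"

text \<open>
  Lebesgue measure on a linear subspace \<open>S\<close> (of dimension \<open>dim S\<close>), extended by zero to the
  ambient space: the image of the product Lebesgue measure under orthonormal coordinates on \<open>S\<close>.
  This mirrors the definition of \<^const>\<open>lborel\<close>, with \<^const>\<open>Basis\<close> replaced by an orthonormal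
  basis of \<open>S\<close>; by rotation invariance the choice of that basis does not matter.
\<close>

definition orthonormal_basis :: "'a::euclidean_space set \<Rightarrow> 'a set \<Rightarrow> bool" where
  "orthonormal_basis S B \<longleftrightarrow>
     B \<subseteq> S \<and> pairwise orthogonal B \<and> (\<forall>b\<in>B. norm b = 1) \<and> span B = S"

definition subspace_lborel :: "'a::euclidean_space set \<Rightarrow> 'a measure" where
  "subspace_lborel S =
     (let B = (SOME B. orthonormal_basis S B)
      in distr (\<Pi>\<^sub>M b\<in>B. lborel) borel (\<lambda>c. \<Sum>b\<in>B. c b *\<^sub>R b))"

definition hyperplane_perp :: "'a::real_inner \<Rightarrow> 'a set" where
  "hyperplane_perp \<xi> = {x. \<xi> \<bullet> x = 0}"

text \<open>
  A section is a null set for the measure itself, so its measure is determined by the density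
  (as a function defined everywhere) and not by the measure alone.
\<close>

definition section_measure ::
    "('a::euclidean_space \<Rightarrow> real) \<Rightarrow> 'a set \<Rightarrow> 'a \<Rightarrow> ennreal" where
  "section_measure f A \<xi> =
     (\<integral>\<^sup>+x\<in>A \<inter> hyperplane_perp \<xi>. ennreal (f x) \<partial>subspace_lborel (hyperplane_perp \<xi>))"

definition log_concave :: "('a::real_vector \<Rightarrow> real) \<Rightarrow> bool" where
  "log_concave f \<longleftrightarrow>
     (\<forall>x. 0 \<le> f x) \<and>
     (\<forall>x y t. 0 < t \<and> t < 1 \<longrightarrow>
        f x powr (1 - t) * f y powr t \<le> f ((1 - t) *\<^sub>R x + t *\<^sub>R y))"

definition log_concave_measure :: "'a::euclidean_space measure \<Rightarrow> bool" where
  "log_concave_measure \<mu> \<longleftrightarrow>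
     (\<exists>f. f \<in> borel_measurable borel \<and> log_concave f \<and> \<mu> = density lborel (\<lambda>x. ennreal (f x)))"

end

theory Submission
  imports "HOL-Probability.Probability" Defs
begin

text \<open>
  Let \<open>\<phi> t = max 0 (t - R)\<close> with \<open>K\<close> and \<open>L\<close> inside \<open>R *\<^sub>R L\<close>.  Then the measure is Lebesgue measure on \<open>K\<close>
  and \<open>L\<close>, and since the density is a decreasing function of the gauge of \<open>L\<close>, the inequality between the
  Lebesgue measures of the sections of \<open>K\<close> and \<open>L\<close> passes to the measures of the sections of all dilates.
  Hence it suffices to refute the Busemann-Petty statement in dimension \<open>n \<ge> 5\<close>.

  Write \<open>m = n - 1\<close>.  Let \<open>L\<close> be a body of revolution about \<open>e\<close> whose gauge is that of a long cylinder plus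
  \<open>d * norm x\<close>, and let the powers \<open>\<rho> ^ m\<close> of the radial functions of \<open>L\<close> and \<open>K\<close> differ by \<open>\<eta> * F\<close> up to a small
  error, where \<open>F = 1 - 2 * m * u\<^sup>2 + m * (m + 2) / 3 * u ^ 4\<close> and \<open>u\<close> is the cosine of the angle with \<open>e\<close>.
  Central sections of \<open>K\<close> are smaller because \<open>F\<close> has nonnegative integrals over great subspheres, which is
  a computation with Gaussian moments.  The volume of \<open>K\<close> is larger because to first order the change is
  \<open>- \<eta> * n / m\<close> times the integral of \<open>F / p\<close>, with \<open>p\<close> the gauge of \<open>L\<close> on the sphere, and this integral is
  negative for the cylinder.  Perturbing the gauge by a multiple of a polynomial in \<open>u\<close> keeps \<open>K\<close> convex,
  thanks to the summand \<open>d * norm x\<close>.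
\<close>

section \<open>Gauges of bodies of revolution\<close>

text \<open>A body of revolution is encoded by \<open>p\<close>, the reciprocal of its radial
  function in terms of the cosine of the angle with the axis, so that sums of profiles are sums of
  gauges. At 0 the quotient is 0 by convention and the factor \<open>norm x\<close> annihilates the
  value of \<open>p\<close>.\<close>

definition axial_gauge :: "'a::real_inner \<Rightarrow> (real \<Rightarrow> real) \<Rightarrow> 'a \<Rightarrow> real" where
  "axial_gauge e p x = norm x * p (e \<bullet> x / norm x)"

lemma cosine_le_1:
  fixes e x :: "'a::real_inner"
  assumes "norm e = 1"
  shows "\<bar>e \<bullet> x / norm x\<bar> \<le> 1"
proof (cases "x = 0")
  case False
  then show ?thesis using Cauchy_Schwarz_ineq2[of e x] assms by (simp add: abs_divide)
qed simp

lemma axial_gauge_scaleR: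
  assumes "c > 0"
  shows "axial_gauge e p (c *\<^sub>R x) = c * axial_gauge e p x"
  using assms by (simp add: axial_gauge_def)

lemma axial_gauge_0 [simp]: "axial_gauge e p 0 = 0"
  by (simp add: axial_gauge_def)

lemma axial_gauge_minus:
  assumes "\<And>u. p (- u) = p u"
  shows "axial_gauge e p (- x) = axial_gauge e p x"
  using assms[of "e \<bullet> x / norm x"] by (simp add: axial_gauge_def)

lemma axial_gauge_add: "axial_gauge e (\<lambda>u. p u + q u) x = axial_gauge e p x + axial_gauge e q x"
  by (simp add: axial_gauge_def algebra_simps)

lemma axial_gauge_bounds:
  assumes "norm e = 1" "\<And>u. \<bar>u\<bar> \<le> 1 \<Longrightarrow> c \<le> p u"
  shows "c * norm x \<le> axial_gauge e p x"
  using mult_left_mono[OF assms(2)[OF cosine_le_1[OF assms(1), of x]], of "norm x"]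
  by (simp add: axial_gauge_def mult.commute)

text \<open>
  The gauge of \<open>p\<close> has at \<open>y \<noteq> 0\<close> the gradient \<open>(p v - v * p' v) *\<^sub>R y / norm y + p' v *\<^sub>R e\<close>
  with \<open>v = e \<bullet> y / norm y\<close>.  The hypothesis says that these gradients are subgradients, because
  \<open>1 - x \<bullet> y = (norm (x - y))\<^sup>2 / 2 \<ge> (u - v)\<^sup>2 / 2\<close> for unit vectors.
\<close>

lemma axial_gauge_triangle:
  fixes e :: "'a::real_inner"
  assumes e: "norm e = 1"
    and nonneg: "\<And>v. \<bar>v\<bar> \<le> 1 \<Longrightarrow> 0 \<le> p v - v * p' v"
    and taylor: "\<And>u v. \<bar>u\<bar> \<le> 1 \<Longrightarrow> \<bar>v\<bar> \<le> 1 \<Longrightarrow>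
       p v + p' v * (u - v) - (p v - v * p' v) * (u - v)\<^sup>2 / 2 \<le> p u"
  shows "axial_gauge e p (x + y) \<le> axial_gauge e p x + axial_gauge e p y"
proof -
  \<comment> \<open>If \<open>x + y = 0\<close> there is no gradient to take; any nonzero vector
    will do, since then \<open>g (x + y) = 0\<close> in any case.\<close>
  define z where "z = (if x + y = 0 then e else x + y)"
  define v where "v = e \<bullet> z / norm z"
  have nz: "norm z > 0" using e by (auto simp: z_def)
  have v: "\<bar>v\<bar> \<le> 1" unfolding v_def by (rule cosine_le_1[OF e])
  \<comment> \<open>\<open>g\<close> is the linear functional given by the gradient at
    \<open>z\<close>. It agrees with the gauge at \<open>z\<close> and lies below it everywhere, so
    its additivity yields the triangle inequality.\<close>
  define g where "g w = (p v - v * p' v) * (z \<bullet> w / norm z) + p' v * (e \<bullet> w)" for w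
  have ge: "g w \<le> axial_gauge e p w" for w
  proof (cases "w = 0")
    case False
    then have nw: "norm w > 0" by simp
    define u where "u = e \<bullet> w / norm w"
    have u: "\<bar>u\<bar> \<le> 1" unfolding u_def by (rule cosine_le_1[OF e])
    define a b where "a = w /\<^sub>R norm w" and "b = z /\<^sub>R norm z"
    have ab: "norm a = 1" "norm b = 1" using nw nz by (simp_all add: a_def b_def)
    have uv: "u - v = e \<bullet> (a - b)" by (simp add: u_def v_def a_def b_def inner_diff_right divide_inverse_commute)
    have "(u - v)\<^sup>2 \<le> (norm (a - b))\<^sup>2"
      unfolding uv using Cauchy_Schwarz_ineq2[of e "a - b"] e by (simp add: abs_le_square_iff[symmetric])
    also have "\<dots> = 2 - 2 * (a \<bullet> b)"
      using ab by (simp add: power2_norm_eq_inner inner_diff_left inner_diff_right inner_commute norm_eq_1)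
    finally have *: "(u - v)\<^sup>2 / 2 \<le> 1 - a \<bullet> b" by simp
    have "(p v - v * p' v) * (a \<bullet> b) + p' v * u
       \<le> p v + p' v * (u - v) - (p v - v * p' v) * (u - v)\<^sup>2 / 2"
      using mult_left_mono[OF * nonneg[OF v]] by (simp add: algebra_simps)
    also have "\<dots> \<le> p u" by (rule taylor[OF u v])
    finally have "norm w * ((p v - v * p' v) * (a \<bullet> b) + p' v * u) \<le> norm w * p u"
      using nw by (intro mult_left_mono) auto
    moreover have "norm w * ((p v - v * p' v) * (a \<bullet> b) + p' v * u) = g w"
    proof -
      have "a \<bullet> b = z \<bullet> w / norm z / norm w"
        by (simp add: a_def b_def inner_commute divide_inverse_commute)
      then show ?thesis using nw by (simp add: g_def u_def distrib_left)
    qed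
    ultimately show ?thesis by (simp add: axial_gauge_def u_def)
  qed (simp add: g_def)
  have "g z = axial_gauge e p z"
  proof -
    have "z \<bullet> z / norm z = norm z" using nz by (simp add: norm_eq_sqrt_inner real_div_sqrt)
    moreover have "e \<bullet> z = norm z * v" using nz by (simp add: v_def)
    ultimately show ?thesis by (simp add: g_def axial_gauge_def v_def[symmetric] algebra_simps)
  qed
  then have "g (x + y) = axial_gauge e p (x + y)"
    by (cases "x + y = 0") (auto simp: z_def g_def)
  moreover have "g (x + y) = g x + g y" 
    by (simp add: g_def inner_add_right add_divide_distrib algebra_simps)
  ultimately show ?thesis using ge[of x] ge[of y] by simp
qed

section \<open>Second-order Taylor bounds for polynomials\<close>

definition quadratic_taylor :: "(real \<Rightarrow> real) \<Rightarrow> bool" where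
  "quadratic_taylor h \<longleftrightarrow> (\<exists>C h'. (\<forall>v. \<bar>v\<bar> \<le> 1 \<longrightarrow> \<bar>h v\<bar> \<le> C \<and> \<bar>h' v\<bar> \<le> C) \<and>
     (\<forall>u v. \<bar>u\<bar> \<le> 1 \<longrightarrow> \<bar>v\<bar> \<le> 1 \<longrightarrow> \<bar>h u - h v - h' v * (u - v)\<bar> \<le> C * (u - v)\<^sup>2))"

text \<open>The estimate is stable under sums and products, so induction on the polynomial delivers
  it together with a slope function and a common constant.\<close>

lemma quadratic_taylor_polynomial:
  assumes "real_polynomial_function h"
  shows "quadratic_taylor h"
  using assms
proof induction
  case (linear f)
  then obtain c where f: "f = (\<lambda>x. x * c)" by (auto simp: real_bounded_linear)
  show ?case unfolding quadratic_taylor_def f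
    by (intro exI[of _ "\<bar>c\<bar>"] exI[of _ "\<lambda>_. c"]) (auto simp: abs_mult mult_left_le_one_le algebra_simps)
next
  case (const c)
  show ?case unfolding quadratic_taylor_def
    by (intro exI[of _ "\<bar>c\<bar>"] exI[of _ "\<lambda>_. 0"]) auto
next
  case (add f g)
  obtain C f' where f: "\<And>v. \<bar>v\<bar> \<le> 1 \<Longrightarrow> \<bar>f v\<bar> \<le> C" "\<And>v. \<bar>v\<bar> \<le> 1 \<Longrightarrow> \<bar>f' v\<bar> \<le> C"
    "\<And>u v. \<bar>u\<bar> \<le> 1 \<Longrightarrow> \<bar>v\<bar> \<le> 1 \<Longrightarrow> \<bar>f u - f v - f' v * (u - v)\<bar> \<le> C * (u - v)\<^sup>2"
    using add.IH(1) unfolding quadratic_taylor_def by metis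
  obtain D g' where g: "\<And>v. \<bar>v\<bar> \<le> 1 \<Longrightarrow> \<bar>g v\<bar> \<le> D" "\<And>v. \<bar>v\<bar> \<le> 1 \<Longrightarrow> \<bar>g' v\<bar> \<le> D"
    "\<And>u v. \<bar>u\<bar> \<le> 1 \<Longrightarrow> \<bar>v\<bar> \<le> 1 \<Longrightarrow> \<bar>g u - g v - g' v * (u - v)\<bar> \<le> D * (u - v)\<^sup>2"
    using add.IH(2) unfolding quadratic_taylor_def by metis
  show ?case unfolding quadratic_taylor_def
  proof (intro exI[of _ "C + D"] exI[of _ "\<lambda>v. f' v + g' v"] conjI allI impI)
    fix u v :: real assume u: "\<bar>u\<bar> \<le> 1" and v: "\<bar>v\<bar> \<le> 1"
    have "f u + g u - (f v + g v) - (f' v + g' v) * (u - v)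
      = (f u - f v - f' v * (u - v)) + (g u - g v - g' v * (u - v))" by (simp add: algebra_simps)
    then show "\<bar>f u + g u - (f v + g v) - (f' v + g' v) * (u - v)\<bar> \<le> (C + D) * (u - v)\<^sup>2"
      using f(3)[OF u v] g(3)[OF u v] unfolding distrib_right by linarith
  next
    fix v :: real assume v: "\<bar>v\<bar> \<le> 1"
    show "\<bar>f v + g v\<bar> \<le> C + D" "\<bar>f' v + g' v\<bar> \<le> C + D" 
      using f(1,2)[OF v] g(1,2)[OF v] by linarith+
  qed
next
  case (mult f g)
  obtain C f' where f: "\<And>v. \<bar>v\<bar> \<le> 1 \<Longrightarrow> \<bar>f v\<bar> \<le> C" "\<And>v. \<bar>v\<bar> \<le> 1 \<Longrightarrow> \<bar>f' v\<bar> \<le> C"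
    "\<And>u v. \<bar>u\<bar> \<le> 1 \<Longrightarrow> \<bar>v\<bar> \<le> 1 \<Longrightarrow> \<bar>f u - f v - f' v * (u - v)\<bar> \<le> C * (u - v)\<^sup>2"
    using mult.IH(1) unfolding quadratic_taylor_def by metis
  obtain D g' where g: "\<And>v. \<bar>v\<bar> \<le> 1 \<Longrightarrow> \<bar>g v\<bar> \<le> D" "\<And>v. \<bar>v\<bar> \<le> 1 \<Longrightarrow> \<bar>g' v\<bar> \<le> D"
    "\<And>u v. \<bar>u\<bar> \<le> 1 \<Longrightarrow> \<bar>v\<bar> \<le> 1 \<Longrightarrow> \<bar>g u - g v - g' v * (u - v)\<bar> \<le> D * (u - v)\<^sup>2"
    using mult.IH(2) unfolding quadratic_taylor_def by metis
  have C: "C \<ge> 0" and D: "D \<ge> 0" using f(1)[of 0] g(1)[of 0] by auto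
  show ?case unfolding quadratic_taylor_def
  \<comment> \<open>The remainder of the product splits into four terms, of sizes 1, 1, 1 and 2
    times \<open>C * D * (u - v)\<^sup>2\<close>. The 2 comes from
    \<open>\<bar>u - v\<bar> \<le> 2\<close>.\<close>
  proof (intro exI[of _ "5 * (C * D)"] exI[of _ "\<lambda>v. f' v * g v + f v * g' v"] conjI allI impI)
    fix u v :: real assume u: "\<bar>u\<bar> \<le> 1" and v: "\<bar>v\<bar> \<le> 1"
    define a b where "a = f u - f v - f' v * (u - v)" and "b = g u - g v - g' v * (u - v)"
    have a: "\<bar>a\<bar> \<le> C * (u - v)\<^sup>2" and b: "\<bar>b\<bar> \<le> D * (u - v)\<^sup>2" 
      using f(3)[OF u v] g(3)[OF u v] by (auto simp: a_def b_def)
    have "f u * g u - f v * g v - (f' v * g v + f v * g' v) * (u - v)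
      = a * g u + f v * b + (f' v * (u - v)) * (g' v * (u - v) + b)"
      by (simp add: a_def b_def algebra_simps power2_eq_square)
    moreover have "\<bar>a * g u\<bar> \<le> C * (u - v)\<^sup>2 * D"
      unfolding abs_mult by (intro mult_mono a g(1) u) (auto simp: C D)
    moreover have "\<bar>f v * b\<bar> \<le> C * (D * (u - v)\<^sup>2)"
      unfolding abs_mult by (intro mult_mono b f(1) v) (auto simp: C D)
    moreover have "\<bar>(f' v * (u - v)) * (g' v * (u - v))\<bar> \<le> (C * \<bar>u - v\<bar>) * (D * \<bar>u - v\<bar>)"
      unfolding abs_mult by (intro mult_mono f(2) g(2) v) (auto simp: C D)
    moreover have "\<bar>(f' v * (u - v)) * b\<bar> \<le> (C * 2) * (D * (u - v)\<^sup>2)"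
      unfolding abs_mult using u v by (intro mult_mono f(2) b v) (auto simp: C D)
    moreover have "(C * \<bar>u - v\<bar>) * (D * \<bar>u - v\<bar>) = C * D * (u - v)\<^sup>2"
      by (simp add: power2_eq_square mult_ac abs_mult_self_eq flip: abs_mult)
    moreover have "C * (u - v)\<^sup>2 * D = C * D * (u - v)\<^sup>2" "C * (D * (u - v)\<^sup>2) = C * D * (u - v)\<^sup>2"
      "(C * 2) * (D * (u - v)\<^sup>2) = 2 * (C * D * (u - v)\<^sup>2)"
      "5 * (C * D) * (u - v)\<^sup>2 = 5 * (C * D * (u - v)\<^sup>2)" by simp_all
    ultimately show "\<bar>f u * g u - f v * g v - (f' v * g v + f v * g' v) * (u - v)\<bar> \<le> 5 * (C * D) * (u - v)\<^sup>2"
      unfolding distrib_left[of "f' v * (u - v)"] by linarith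
  next
    fix v :: real assume v: "\<bar>v\<bar> \<le> 1"
    have "\<bar>f v * g v\<bar> \<le> C * D" "\<bar>f' v * g v\<bar> \<le> C * D" "\<bar>f v * g' v\<bar> \<le> C * D"
      unfolding abs_mult by (intro mult_mono f g v; simp add: C D)+
    moreover have "C * D \<ge> 0" using C D by simp
    ultimately show "\<bar>f v * g v\<bar> \<le> 5 * (C * D)" "\<bar>f' v * g v + f v * g' v\<bar> \<le> 5 * (C * D)"
      by linarith+
  qed
qed

section \<open>Gauges and their unit balls\<close>

locale body_gauge =
  fixes N :: "'a::euclidean_space \<Rightarrow> real" and c :: real
  assumes triangle: "N (x + y) \<le> N x + N y"
    and hom: "r > 0 \<Longrightarrow> N (r *\<^sub>R x) = r * N x"
    and even: "N (- x) = N x"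
    and c_pos: "c > 0"
    and lower: "c * norm x \<le> N x"
begin

lemma zero: "N 0 = 0"
  using hom[of 2 0] by simp

lemma pos: "x \<noteq> 0 \<Longrightarrow> N x > 0"
  using lower[of x] c_pos by (smt (verit) mult_pos_pos zero_less_norm_iff)

lemma nonneg: "N x \<ge> 0"
  using zero pos[of x] by (cases "x = 0") auto

lemma hom_nonneg: "r \<ge> 0 \<Longrightarrow> N (r *\<^sub>R x) = r * N x"
  using hom[of r x] zero by (cases "r = 0") auto

lemma convex: "convex_on UNIV N"
proof (rule convex_onI)
  fix t :: real and x y assume "0 < t" "t < 1"
  then show "N ((1 - t) *\<^sub>R x + t *\<^sub>R y) \<le> (1 - t) * N x + t * N y"
    using triangle[of "(1 - t) *\<^sub>R x" "t *\<^sub>R y"] by (simp add: hom)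
qed simp

lemma continuous: "continuous_on UNIV N"
  using convex by (rule convex_on_continuous[OF open_UNIV])

lemma measurable [measurable]: "N \<in> borel_measurable borel"
  using continuous by (rule borel_measurable_continuous_onI)

lemma closed_le: "closed {x. N x \<le> r}"
  using continuous by (intro closed_Collect_le) auto

lemma bounded_le: "bounded {x. N x \<le> r}"
proof (rule boundedI)
  fix x assume "x \<in> {x. N x \<le> r}"
  then show "norm x \<le> r / c" 
    using lower[of x] c_pos by (simp add: pos_le_divide_eq mult.commute)
qed

lemma convex_body: "convex_body {x. N x \<le> 1}"
proof -
  have "convex {x. N x \<le> 1}"
  proof (rule convexI)
    fix x y and u v :: real
    assume xy: "x \<in> {x. N x \<le> 1}" "y \<in> {x. N x \<le> 1}" and uv: "0 \<le> u" "0 \<le> v" "u + v = 1"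
    have "N (u *\<^sub>R x + v *\<^sub>R y) \<le> u * N x + v * N y"
      using triangle[of "u *\<^sub>R x" "v *\<^sub>R y"] uv by (simp add: hom_nonneg)
    also have "\<dots> \<le> u * 1 + v * 1" using xy uv by (intro add_mono mult_left_mono) auto
    finally show "u *\<^sub>R x + v *\<^sub>R y \<in> {x. N x \<le> 1}" using uv by simp
  qed
  moreover have "compact {x. N x \<le> 1}"
    using closed_le bounded_le by (simp add: compact_eq_bounded_closed)
  moreover have "0 \<in> interior {x. N x \<le> 1}"
  proof (rule interiorI)
    show "open {x. N x < 1}" using continuous by (intro open_Collect_less) auto
  qed (auto simp: zero)
  ultimately show ?thesis unfolding convex_body_def by auto
qed

lemma symmetric: "symmetric_set {x. N x \<le> 1}"
  unfolding symmetric_set_def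
proof (intro equalityI subsetI)
  fix x assume "x \<in> {x. N x \<le> 1}"
  then show "x \<in> uminus ` {x. N x \<le> 1}" 
    by (intro image_eqI[of _ _ "- x"]) (auto simp: even)
qed (auto simp: even)

lemma scaleR_image: "r > 0 \<Longrightarrow> (*\<^sub>R) r ` {x. N x \<le> 1} = {x. N x \<le> r}"
proof (intro equalityI subsetI)
  fix x assume r: "r > 0" and "x \<in> {x. N x \<le> r}"
  then show "x \<in> (*\<^sub>R) r ` {x. N x \<le> 1}" 
    by (intro image_eqI[of _ _ "x /\<^sub>R r"]) (auto simp: hom field_simps)
qed (auto simp: hom)

lemma minkowski_functional: "minkowski_functional {x. N x \<le> 1} = N"
proof
  fix x show "minkowski_functional {x. N x \<le> 1} x = N x"
  proof (cases "x = 0")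
    case False
    have "(LEAST t. 0 < t \<and> x \<in> (*\<^sub>R) t ` {x. N x \<le> 1}) = N x"
      using pos[OF False] by (intro Least_equality) (auto simp: scaleR_image hom mult_le_cancel_left1 intro: mult_left_le)
    then show ?thesis using False by (simp add: minkowski_functional_def)
  qed (simp add: minkowski_functional_def zero)
qed

end

section \<open>Truncated exponential densities\<close>

lemma convex_on_truncation: "convex_on UNIV (\<lambda>t::real. max 0 (t - R))"
proof (rule convex_onI)
  fix t x y :: real assume t: "0 < t" "t < 1"
  have "(1 - t) * (x - R) \<le> (1 - t) * max 0 (x - R)" "t * (y - R) \<le> t * max 0 (y - R)"
    using t by (auto intro!: mult_left_mono)
  moreover have "0 \<le> (1 - t) * max 0 (x - R)" "0 \<le> t * max 0 (y - R)" using t by auto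
  ultimately show "max 0 ((1 - t) *\<^sub>R x + t *\<^sub>R y - R) \<le> (1 - t) * max 0 (x - R) + t * max 0 (y - R)"
    by (simp add: max_def algebra_simps split del: if_split) (simp add: algebra_simps split: if_splits)
qed simp

text \<open>The truncation is convex and nondecreasing, so its composition with the convex gauge is
  convex, and the exponential of minus a convex function is log-concave.\<close>

lemma (in body_gauge) log_concave_truncation:
  "log_concave (\<lambda>x. exp (- max 0 (N x - R)))"
  unfolding log_concave_def
proof (intro conjI allI impI)
  fix x y :: 'a and t :: real assume t: "0 < t \<and> t < 1"
  have "max 0 (N ((1 - t) *\<^sub>R x + t *\<^sub>R y) - R) \<le> max 0 ((1 - t) * N x + t * N y - R)"
    using convex_onD[OF convex, of t x y] t by simp
  also have "\<dots> \<le> (1 - t) * max 0 (N x - R) + t * max 0 (N y - R)"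
    using convex_onD[OF convex_on_truncation, of t "N x" "N y" R] t by simp
  finally show "exp (- max 0 (N x - R)) powr (1 - t) * exp (- max 0 (N y - R)) powr t
      \<le> exp (- max 0 (N ((1 - t) *\<^sub>R x + t *\<^sub>R y) - R))"
    by (simp add: powr_def algebra_simps del: max.bounded_iff flip: exp_add)
qed simp

text \<open>The density is at least \<open>a\<close> on the sublevel set \<open>C\<close> and at most \<open>a\<close> off it,
  so among sets of given measure it favours \<open>C\<close>.\<close>

lemma nn_integral_superlevel_mono:
  assumes [measurable]: "f \<in> borel_measurable M" "A \<in> sets M" "C \<in> sets M"
    and fin: "emeasure M C < \<infinity>" and le: "emeasure M A \<le> emeasure M C"
    and a: "a < \<infinity>" "\<And>x. x \<in> C \<Longrightarrow> a \<le> f x" "\<And>x. x \<notin> C \<Longrightarrow> f x \<le> (a::ennreal)"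
  shows "(\<integral>\<^sup>+x\<in>A. f x \<partial>M) \<le> (\<integral>\<^sup>+x\<in>C. f x \<partial>M)"
proof -
  \<comment> \<open>This integrates
    \<open>(f x - a) * (indicator A x - indicator C x) \<le> 0\<close>, rearranged without
    subtraction. In the end \<open>a * emeasure M C\<close> is cancelled, which is why it has to be
    finite.\<close>
  have "(\<integral>\<^sup>+x\<in>A. f x \<partial>M) + a * emeasure M C = (\<integral>\<^sup>+x. f x * indicator A x + a * indicator C x \<partial>M)"
    by (subst nn_integral_add) (auto simp: nn_integral_cmult_indicator)
  also have "\<dots> \<le> (\<integral>\<^sup>+x. f x * indicator C x + a * indicator A x \<partial>M)"
    using a(2,3) by (intro nn_integral_mono) (auto simp: indicator_def add.commute add_mono)
  also have "\<dots> = (\<integral>\<^sup>+x\<in>C. f x \<partial>M) + a * emeasure M A"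
    by (subst nn_integral_add) (auto simp: nn_integral_cmult_indicator)
  also have "\<dots> \<le> (\<integral>\<^sup>+x\<in>C. f x \<partial>M) + a * emeasure M C"
    using le by (intro add_left_mono mult_left_mono) auto
  finally show ?thesis
    using a(1) fin by (auto simp: ennreal_add_left_cancel_le add.commute[of _ "a * _"] ennreal_mult_eq_top_iff)
qed

section \<open>Gaussian moments and central sections\<close>

interpretation lborel_product: product_sigma_finite "\<lambda>_. lborel :: real measure" ..

abbreviation coord_lborel :: "'i set \<Rightarrow> ('i \<Rightarrow> real) measure" where
  "coord_lborel B \<equiv> \<Pi>\<^sub>M b\<in>B. lborel"

text \<open>The moments of order 0 to 4 of the standard normal distribution are 1, 0, 1, 0,
  3.\<close>

lemma nn_integral_std_normal_quartic:
  fixes p :: "real \<Rightarrow> real"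
  assumes p: "\<And>y. p y = a0 + a1 * y + a2 * y^2 + a3 * y^3 + a4 * y^4" and nonneg: "\<And>y. 0 \<le> p y"
  shows "(\<integral>\<^sup>+y. ennreal (std_normal_density y * p y) \<partial>lborel) = ennreal (a0 + a2 + 3 * a4)"
proof -
  let ?n = std_normal_density
  have m: "has_bochner_integral lborel (\<lambda>y. ?n y * y^0) 1" "has_bochner_integral lborel (\<lambda>y. ?n y * y^1) 0"
    "has_bochner_integral lborel (\<lambda>y. ?n y * y^2) 1" "has_bochner_integral lborel (\<lambda>y. ?n y * y^3) 0"
    "has_bochner_integral lborel (\<lambda>y. ?n y * y^4) 3"
    using std_normal_moment_even[of 0] std_normal_moment_odd[of 0] std_normal_moment_even[of 1]
      std_normal_moment_odd[of 1] std_normal_moment_even[of 2]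
    by (simp_all add: fact_numeral eval_nat_numeral)
  have "has_bochner_integral lborel (\<lambda>y. a0 * (?n y * y^0) + a1 * (?n y * y^1) + a2 * (?n y * y^2)
      + a3 * (?n y * y^3) + a4 * (?n y * y^4)) (a0 * 1 + a1 * 0 + a2 * 1 + a3 * 0 + a4 * 3)"
    by (intro has_bochner_integral_add has_bochner_integral_mult_right m)
  then have "has_bochner_integral lborel (\<lambda>y. ?n y * p y) (a0 + a2 + 3 * a4)"
    by (simp add: p algebra_simps)
  then show ?thesis
    using nonneg by (subst nn_integral_eq_integral) (auto simp: has_bochner_integral_iff)
qed

text \<open>Fubini's theorem in one coordinate: with the others fixed, \<open>F\<close> is a quartic
  in the new coordinate \<open>y\<close>, and integration replaces \<open>y\<^sup>2\<close> by 1,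
  \<open>y ^ 4\<close> by 3 and odd powers by 0.\<close>

lemma nn_integral_coord_gaussian_insert:
  assumes B: "finite B" "b \<notin> B"
    and [measurable]: "case_prod G \<in> borel_measurable (coord_lborel B \<Otimes>\<^sub>M lborel)"
    and nonneg: "\<And>x y. 0 \<le> G x y"
    and G: "\<And>x y. G x y = a0 x + a1 x * y + a2 x * y^2 + a3 x * y^3 + a4 x * y^4"
    and F: "\<And>x y. F (x(b := y)) = G x y"
    and [measurable]: "F \<in> borel_measurable (coord_lborel (insert b B))"
  shows "(\<integral>\<^sup>+c. ennreal ((\<Prod>b\<in>insert b B. std_normal_density (c b)) * F c) \<partial>coord_lborel (insert b B))
    = (\<integral>\<^sup>+c. ennreal ((\<Prod>b\<in>B. std_normal_density (c b)) * (a0 c + a2 c + 3 * a4 c)) \<partial>coord_lborel B)"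
proof -
  have "(\<integral>\<^sup>+c. ennreal ((\<Prod>b\<in>insert b B. std_normal_density (c b)) * F c) \<partial>coord_lborel (insert b B))
    = (\<integral>\<^sup>+x. \<integral>\<^sup>+y. ennreal ((\<Prod>d\<in>insert b B. std_normal_density ((x(b := y)) d)) * F (x(b := y))) \<partial>lborel \<partial>coord_lborel B)"
    using B by (intro lborel_product.product_nn_integral_insert) auto
  also have "\<dots> = (\<integral>\<^sup>+x. \<integral>\<^sup>+y. ennreal (\<Prod>d\<in>B. std_normal_density (x d)) * ennreal (std_normal_density y * G x y) \<partial>lborel \<partial>coord_lborel B)"
  proof (intro nn_integral_cong)
    fix x y
    have "(\<Prod>d\<in>B. std_normal_density ((x(b := y)) d)) = (\<Prod>d\<in>B. std_normal_density (x d))"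
      using B by (intro prod.cong) auto
    then show "ennreal ((\<Prod>d\<in>insert b B. std_normal_density ((x(b := y)) d)) * F (x(b := y)))
       = ennreal (\<Prod>d\<in>B. std_normal_density (x d)) * ennreal (std_normal_density y * G x y)"
      using B nonneg[of x y] by (simp add: F mult_ac prod_nonneg flip: ennreal_mult)
  qed
  also have "\<dots> = (\<integral>\<^sup>+x. ennreal (\<Prod>d\<in>B. std_normal_density (x d)) * (\<integral>\<^sup>+y. ennreal (std_normal_density y * G x y) \<partial>lborel) \<partial>coord_lborel B)"
    by (intro nn_integral_cong nn_integral_cmult) simp
  also have "\<dots> = (\<integral>\<^sup>+c. ennreal ((\<Prod>b\<in>B. std_normal_density (c b)) * (a0 c + a2 c + 3 * a4 c)) \<partial>coord_lborel B)"
    by (intro nn_integral_cong, subst nn_integral_std_normal_quartic[OF G nonneg])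
      (simp add: ennreal_mult' prod_nonneg)
  finally show ?thesis .
qed

text \<open>Induction on the number of coordinates. The moments are proved together because
  splitting off a coordinate produces, from those of degree 4, also those of degree 2.
  \<open>q\<close> is the squared norm, \<open>t\<close> a linear functional and \<open>A\<close>
  the squared norm of its coefficient vector.\<close>

lemma gaussian_moments:
  fixes a :: "'i \<Rightarrow> real"
  assumes "finite B"
  defines "E \<equiv> \<lambda>B F. \<integral>\<^sup>+c. ennreal ((\<Prod>b\<in>B. std_normal_density (c b)) * F c) \<partial>coord_lborel B"
    and "q \<equiv> \<lambda>B c. \<Sum>b\<in>B. (c b)\<^sup>2" and "t \<equiv> \<lambda>B c. \<Sum>b\<in>B. a b * c b"
    and "k \<equiv> \<lambda>B. real (card B)" and "A \<equiv> \<lambda>B. \<Sum>b\<in>B. (a b)\<^sup>2"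
  shows "E B (\<lambda>_. 1) = 1 \<and> E B (q B) = ennreal (k B) \<and> E B (\<lambda>c. (t B c)\<^sup>2) = ennreal (A B)
    \<and> E B (\<lambda>c. (q B c)\<^sup>2) = ennreal (k B * (k B + 2))
    \<and> E B (\<lambda>c. q B c * (t B c)\<^sup>2) = ennreal ((k B + 2) * A B)
    \<and> E B (\<lambda>c. (t B c)^4) = ennreal (3 * (A B)\<^sup>2)"
  using assms(1)
proof (induction rule: finite_induct)
  case empty
  then show ?case 
    by (simp add: E_def q_def t_def k_def A_def lborel_product.nn_integral_empty)
next
  case (insert b B)
  have [measurable]: "q B \<in> borel_measurable (coord_lborel B)" "t B \<in> borel_measurable (coord_lborel B)" for B
    unfolding q_def t_def by measurable
  have q0: "0 \<le> q B c" for c B by (simp add: q_def sum_nonneg)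
  have t40: "0 \<le> (t B c)^4" for c B by (simp add: zero_le_even_power)
  have A0: "0 \<le> A B" and k0: "0 \<le> k B" for B by (simp_all add: A_def k_def sum_nonneg)
  have qi: "q (insert b B) (c(b := y)) = q B c + y\<^sup>2" for c y
    using insert.hyps by (simp add: q_def) (intro sum.cong, auto)
  have ti: "t (insert b B) (c(b := y)) = t B c + a b * y" for c y
    using insert.hyps by (simp add: t_def) (intro sum.cong, auto)
  have ki: "k (insert b B) = k B + 1" using insert.hyps by (simp add: k_def)
  have Ai: "A (insert b B) = A B + (a b)\<^sup>2" using insert.hyps by (simp add: A_def)
  have W0: "0 \<le> (\<Prod>b\<in>B. std_normal_density (c b))" for c by (simp add: prod_nonneg)
  have E_add: "E B (\<lambda>c. F c + G c) = E B F + E B G"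
    if [measurable]: "F \<in> borel_measurable (coord_lborel B)" "G \<in> borel_measurable (coord_lborel B)"
      and "\<And>c. 0 \<le> F c" "\<And>c. 0 \<le> G c" for F G
    unfolding E_def by (subst nn_integral_add[symmetric])
      (auto intro!: nn_integral_cong simp: W0 that distrib_left simp flip: ennreal_plus)
  have E_mult: "E B (\<lambda>c. r * F c) = ennreal r * E B F"
    if [measurable]: "F \<in> borel_measurable (coord_lborel B)"
      and "\<And>c. 0 \<le> F c" "0 \<le> r" for F r
    unfolding E_def by (subst nn_integral_cmult[symmetric])
      (auto intro!: nn_integral_cong simp: W0 that mult_ac simp flip: ennreal_mult)
  note IH = insert.IH
  have E_const: "E B (\<lambda>_. r) = ennreal r" if "0 \<le> r" for r
    using E_mult[of "\<lambda>_. 1" r] IH that by simp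
  have E_eq: "(\<integral>\<^sup>+c. ennreal ((\<Prod>b\<in>B. std_normal_density (c b)) * F c) \<partial>coord_lborel B) = E B F" for B F
    by (simp add: E_def)
  note ins = nn_integral_coord_gaussian_insert[OF insert.hyps, unfolded E_eq]
  \<comment> \<open>Here and below the integrand on the right has the shape
    \<open>a0 + a2 + 3 * a4\<close>, from which unification reads off the even coefficients. The odd
    ones do not survive integration and are given explicitly.\<close>
  have "E (insert b B) (\<lambda>_. 1) = E B (\<lambda>c. 1 + 0 + 3 * 0)"
    by (rule ins[where G = "\<lambda>_ _. 1" and ?a1.0 = "\<lambda>_. 0" and ?a3.0 = "\<lambda>_. 0"]) (((simp add: q0 qi ti; fail) | (measurable; fail) | (simp add: power2_eq_square power3_eq_cube power4_eq_xxxx algebra_simps; fail))+)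
  then have 1: "E (insert b B) (\<lambda>_. 1) = 1" using IH by simp
  have "E (insert b B) (q (insert b B)) = E B (\<lambda>c. q B c + 1 + 3 * 0)"
    by (rule ins[where G = "\<lambda>c y. q B c + y\<^sup>2" and ?a1.0 = "\<lambda>_. 0" and ?a3.0 = "\<lambda>_. 0"]) (((simp add: q0 qi ti; fail) | (measurable; fail) | (simp add: power2_eq_square power3_eq_cube power4_eq_xxxx algebra_simps; fail))+)
  then have 2: "E (insert b B) (q (insert b B)) = ennreal (k (insert b B))" 
    using IH by (simp add: E_add q0 ki k0 flip: ennreal_1 ennreal_plus)
  have "E (insert b B) (\<lambda>c. (t (insert b B) c)\<^sup>2) = E B (\<lambda>c. (t B c)\<^sup>2 + (a b)\<^sup>2 + 3 * 0)"
    by (rule ins[where G = "\<lambda>c y. (t B c + a b * y)\<^sup>2" and ?a1.0 = "\<lambda>c. 2 * a b * t B c" and ?a3.0 = "\<lambda>_. 0"])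
      (((simp add: q0 qi ti; fail) | (measurable; fail) | (simp add: power2_eq_square power3_eq_cube power4_eq_xxxx algebra_simps; fail))+)
  also have "\<dots> = ennreal (A (insert b B))" 
    using IH by (simp add: E_add E_const Ai A0)
  finally have 3: "E (insert b B) (\<lambda>c. (t (insert b B) c)\<^sup>2) = ennreal (A (insert b B))" .
  have "E (insert b B) (\<lambda>c. (q (insert b B) c)\<^sup>2) = E B (\<lambda>c. (q B c)\<^sup>2 + 2 * q B c + 3 * 1)"
    by (rule ins[where G = "\<lambda>c y. (q B c + y\<^sup>2)\<^sup>2" and ?a1.0 = "\<lambda>_. 0" and ?a3.0 = "\<lambda>_. 0"]) 
      (((simp add: q0 qi ti; fail) | (measurable; fail) | (simp add: power2_eq_square power3_eq_cube power4_eq_xxxx algebra_simps; fail))+)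
  also have "\<dots> = ennreal (k B * (k B + 2)) + ennreal 2 * ennreal (k B) + ennreal 3"
    using IH by (simp add: E_add E_mult E_const q0 k0 A0 ennreal_mult)
  also have "\<dots> = ennreal (k B * (k B + 2) + 2 * k B + 3)"
    by (simp add: k0 ennreal_mult)
  also have "k B * (k B + 2) + 2 * k B + 3 = k (insert b B) * (k (insert b B) + 2)"
    by (simp add: ki algebra_simps)
  finally have 4: "E (insert b B) (\<lambda>c. (q (insert b B) c)\<^sup>2) = ennreal (k (insert b B) * (k (insert b B) + 2))" .
  have "E (insert b B) (\<lambda>c. q (insert b B) c * (t (insert b B) c)\<^sup>2) 
     = E B (\<lambda>c. q B c * (t B c)\<^sup>2 + ((a b)\<^sup>2 * q B c + (t B c)\<^sup>2) + 3 * (a b)\<^sup>2)"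
    by (rule ins[where G = "\<lambda>c y. (q B c + y\<^sup>2) * (t B c + a b * y)\<^sup>2" and 
          ?a1.0 = "\<lambda>c. 2 * a b * t B c * q B c" and ?a3.0 = "\<lambda>c. 2 * a b * t B c"]) 
      (((simp add: q0 qi ti; fail) | (measurable; fail) | (simp add: power2_eq_square power3_eq_cube power4_eq_xxxx algebra_simps; fail))+)
  also have "\<dots> = ennreal ((k B + 2) * A B) + (ennreal ((a b)\<^sup>2) * ennreal (k B) + ennreal (A B)) + ennreal (3 * (a b)\<^sup>2)"
    using IH by (simp add: E_add E_mult E_const q0 k0 A0 ennreal_mult)
  also have "\<dots> = ennreal ((k B + 2) * A B + ((a b)\<^sup>2 * k B + A B) + 3 * (a b)\<^sup>2)"
    by (simp add: k0 A0 ennreal_mult)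
  also have "(k B + 2) * A B + ((a b)\<^sup>2 * k B + A B) + 3 * (a b)\<^sup>2 = (k (insert b B) + 2) * A (insert b B)"
    by (simp add: ki Ai algebra_simps)
  finally have 5: "E (insert b B) (\<lambda>c. q (insert b B) c * (t (insert b B) c)\<^sup>2) = ennreal ((k (insert b B) + 2) * A (insert b B))" .
  have "E (insert b B) (\<lambda>c. (t (insert b B) c)^4) 
     = E B (\<lambda>c. (t B c)^4 + 6 * (a b)\<^sup>2 * (t B c)\<^sup>2 + 3 * (a b)^4)"
    by (rule ins[where G = "\<lambda>c y. (t B c + a b * y)^4" and 
          ?a1.0 = "\<lambda>c. 4 * a b * (t B c)^3" and ?a3.0 = "\<lambda>c. 4 * (a b)^3 * t B c"]) 
      (((simp add: q0 qi ti; fail) | (measurable; fail) | (simp add: power2_eq_square power3_eq_cube power4_eq_xxxx algebra_simps; fail))+)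
  also have "\<dots> = ennreal (3 * (A B)\<^sup>2) + ennreal (6 * (a b)\<^sup>2) * ennreal (A B) + ennreal (3 * (a b)^4)"
    using IH by (simp add: E_add E_mult E_const zero_le_even_power k0 A0 ennreal_mult)
  also have "\<dots> = ennreal (3 * (A B)\<^sup>2 + 6 * (a b)\<^sup>2 * A B + 3 * (a b)^4)"
    by (simp add: A0 ennreal_mult zero_le_even_power)
  also have "3 * (A B)\<^sup>2 + 6 * (a b)\<^sup>2 * A B + 3 * (a b)^4 = 3 * (A (insert b B))\<^sup>2"
    by (simp add: Ai power2_eq_square power4_eq_xxxx algebra_simps)
  finally have 6: "E (insert b B) (\<lambda>c. (t (insert b B) c)^4) = ennreal (3 * (A (insert b B))\<^sup>2)" .
  show ?case using 1 2 3 4 5 6 by simp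
qed

section \<open>Lebesgue measure on spans, with the basis explicit\<close>

definition span_lborel :: "'a::euclidean_space set \<Rightarrow> 'a measure" where
  "span_lborel B = distr (coord_lborel B) borel (\<lambda>c. \<Sum>b\<in>B. c b *\<^sub>R b)"

lemma sets_span_lborel [simp, measurable_cong]: "sets (span_lborel B) = sets borel"
  by (simp add: span_lborel_def)

lemma space_span_lborel [simp]: "space (span_lborel B) = UNIV"
  by (simp add: span_lborel_def)

lemma nn_integral_span_lborel:
  assumes [measurable]: "g \<in> borel_measurable borel"
  shows "(\<integral>\<^sup>+x. g x \<partial>span_lborel B) = (\<integral>\<^sup>+c. g (\<Sum>b\<in>B. c b *\<^sub>R b) \<partial>coord_lborel B)"
  unfolding span_lborel_def by (subst nn_integral_distr) auto

lemma nn_integral_lborel_scale: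
  fixes f :: "real \<Rightarrow> ennreal"
  assumes [measurable]: "f \<in> borel_measurable borel" and "r > 0"
  shows "(\<integral>\<^sup>+x. f x \<partial>lborel) = ennreal r * (\<integral>\<^sup>+x. f (r * x) \<partial>lborel)"
  using nn_integral_real_affine[of f r 0] assms by simp

text \<open>One coordinate at a time, each contributing a factor \<open>r\<close>. The offset
  \<open>a\<close> is general because the induction hypothesis is applied with the new coordinate
  frozen.\<close>

lemma nn_integral_coord_scale:
  fixes g :: "'a::euclidean_space \<Rightarrow> ennreal"
  assumes B: "finite B" and r: "r > 0" and [measurable]: "g \<in> borel_measurable borel"
  shows "(\<integral>\<^sup>+c. g (a + (\<Sum>b\<in>B. c b *\<^sub>R b)) \<partial>coord_lborel B)
    = ennreal (r ^ card B) * (\<integral>\<^sup>+c. g (a + r *\<^sub>R (\<Sum>b\<in>B. c b *\<^sub>R b)) \<partial>coord_lborel B)"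
  using B
proof (induction arbitrary: a)
  case empty
  then show ?case by (simp add: lborel_product.nn_integral_empty)
next
  case (insert b B)
  interpret sB: sigma_finite_measure "coord_lborel B"
    by (rule lborel_product.sigma_finite) fact
  have upd: "(\<Sum>d\<in>insert b B. (c(b := y)) d *\<^sub>R d) = y *\<^sub>R b + (\<Sum>d\<in>B. c d *\<^sub>R d)" for c :: "'a \<Rightarrow> real" and y
    using insert.hyps by simp (intro sum.cong, auto)
  note upd = upd upd[simplified fun_upd_apply]
  have "(\<integral>\<^sup>+c. g (a + (\<Sum>b\<in>insert b B. c b *\<^sub>R b)) \<partial>coord_lborel (insert b B))
    = (\<integral>\<^sup>+y. \<integral>\<^sup>+c. g (a + y *\<^sub>R b + (\<Sum>d\<in>B. c d *\<^sub>R d)) \<partial>coord_lborel B \<partial>lborel)"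
    using insert.hyps by (subst lborel_product.product_nn_integral_insert_rev) (simp_all add: upd add.assoc)
  also have "\<dots> = ennreal r * (\<integral>\<^sup>+y. \<integral>\<^sup>+c. g (a + (r * y) *\<^sub>R b + (\<Sum>d\<in>B. c d *\<^sub>R d)) \<partial>coord_lborel B \<partial>lborel)"
    using r by (intro nn_integral_lborel_scale) measurable
  also have "\<dots> = ennreal r * (\<integral>\<^sup>+y. ennreal (r ^ card B) * 
      (\<integral>\<^sup>+c. g (a + (r * y) *\<^sub>R b + r *\<^sub>R (\<Sum>d\<in>B. c d *\<^sub>R d)) \<partial>coord_lborel B) \<partial>lborel)"
    by (subst insert.IH) simp
  also have "\<dots> = ennreal (r ^ card (insert b B)) * (\<integral>\<^sup>+y. 
      (\<integral>\<^sup>+c. g (a + (r * y) *\<^sub>R b + r *\<^sub>R (\<Sum>d\<in>B. c d *\<^sub>R d)) \<partial>coord_lborel B) \<partial>lborel)"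
    using r insert.hyps by (subst nn_integral_cmult) (auto simp: ennreal_mult mult_ac)
  also have "(\<integral>\<^sup>+y. (\<integral>\<^sup>+c. g (a + (r * y) *\<^sub>R b + r *\<^sub>R (\<Sum>d\<in>B. c d *\<^sub>R d)) \<partial>coord_lborel B) \<partial>lborel)
    = (\<integral>\<^sup>+c. g (a + r *\<^sub>R (\<Sum>b\<in>insert b B. c b *\<^sub>R b)) \<partial>coord_lborel (insert b B))"
    using insert.hyps by (subst lborel_product.product_nn_integral_insert_rev) (simp_all add: upd scaleR_add_right add.assoc)
  finally show ?case .
qed

lemma nn_integral_span_lborel_scale:
  fixes g :: "'a::euclidean_space \<Rightarrow> ennreal"
  assumes "finite B" "r > 0" and [measurable]: "g \<in> borel_measurable borel"
  shows "(\<integral>\<^sup>+x. g x \<partial>span_lborel B) = ennreal (r ^ card B) * (\<integral>\<^sup>+x. g (r *\<^sub>R x) \<partial>span_lborel B)"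
  using nn_integral_coord_scale[OF assms, of 0] by (simp add: nn_integral_span_lborel)

lemma sigma_finite_span_lborel:
  assumes "finite (B :: 'a::euclidean_space set)" 
    and fin: "\<And>r. emeasure (span_lborel B) (cball 0 r) < \<infinity>"
  shows "sigma_finite_measure (span_lborel B)"
proof
  show "\<exists>A. countable A \<and> A \<subseteq> sets (span_lborel B) \<and> \<Union> A = space (span_lborel B) 
    \<and> (\<forall>a\<in>A. emeasure (span_lborel B) a \<noteq> \<infinity>)"
  proof (intro exI[of _ "range (\<lambda>n::nat. cball 0 (real n))"] conjI)
    show "\<Union> (range (\<lambda>n::nat. cball 0 (real n))) = space (span_lborel B)"
      by (auto simp: real_arch_simple)
  qed (use fin in \<open>auto simp: less_top\<close>)
qed

locale orthonormal_set =
  fixes B :: "'a::euclidean_space set"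
  assumes orthogonal: "pairwise orthogonal B" and unit: "\<And>b. b \<in> B \<Longrightarrow> norm b = 1"
begin

lemma finite: "finite B"
  using orthogonal by (rule pairwise_orthogonal_imp_finite)

lemma inner_sum:
  assumes "d \<in> B"
  shows "(\<Sum>b\<in>B. c b *\<^sub>R b) \<bullet> d = c d"
proof -
  have "(\<Sum>b\<in>B. c b *\<^sub>R b) \<bullet> d = (\<Sum>b\<in>B. c b * (b \<bullet> d))" by (simp add: inner_sum_left)
  also have "\<dots> = (\<Sum>b\<in>B. if b = d then c d else 0)"
    using orthogonal unit assms by (intro sum.cong) (auto simp: pairwise_def orthogonal_def norm_eq_1)
  finally show ?thesis using assms finite by simp
qed

lemma norm_sum: "(norm (\<Sum>b\<in>B. c b *\<^sub>R b))\<^sup>2 = (\<Sum>b\<in>B. (c b)\<^sup>2)"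
proof -
  have "(norm (\<Sum>b\<in>B. c b *\<^sub>R b))\<^sup>2 = (\<Sum>d\<in>B. c d * ((\<Sum>b\<in>B. c b *\<^sub>R b) \<bullet> d))"
    by (simp add: power2_norm_eq_inner inner_sum_right)
  also have "\<dots> = (\<Sum>b\<in>B. (c b)\<^sup>2)"
    by (intro sum.cong) (auto simp: inner_sum power2_eq_square)
  finally show ?thesis .
qed

lemma emeasure_cball_finite: "emeasure (span_lborel B) (cball 0 r) < \<infinity>"
proof -
  \<comment> \<open>By Cauchy-Schwarz the coordinates of a point are bounded by its norm, so the
    preimage of the ball lies in a cube; the absolute value covers negative
    \<open>r\<close>.\<close>
  let ?I = "\<lambda>_. {- \<bar>r\<bar>..\<bar>r\<bar>}"
  have "emeasure (span_lborel B) (cball 0 r) = emeasure (coord_lborel B) 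
      ((\<lambda>c. \<Sum>b\<in>B. c b *\<^sub>R b) -` cball 0 r \<inter> space (coord_lborel B))"
    unfolding span_lborel_def by (rule emeasure_distr) auto
  also have "\<dots> \<le> emeasure (coord_lborel B) (Pi\<^sub>E B ?I)"
  proof (rule emeasure_mono)
    show "(\<lambda>c. \<Sum>b\<in>B. c b *\<^sub>R b) -` cball 0 r \<inter> space (coord_lborel B) \<subseteq> Pi\<^sub>E B ?I"
    proof
      fix c assume c: "c \<in> (\<lambda>c. \<Sum>b\<in>B. c b *\<^sub>R b) -` cball 0 r \<inter> space (coord_lborel B)"
      have "c d \<in> {- \<bar>r\<bar>..\<bar>r\<bar>}" if d: "d \<in> B" for d
      proof -
        have "\<bar>c d\<bar> \<le> norm (\<Sum>b\<in>B. c b *\<^sub>R b) * norm d"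
          using Cauchy_Schwarz_ineq2[of "\<Sum>b\<in>B. c b *\<^sub>R b" d] inner_sum[OF d] by simp
        also have "\<dots> \<le> \<bar>r\<bar>" using c unit[OF d] by auto
        finally show ?thesis by auto
      qed
      then show "c \<in> Pi\<^sub>E B ?I" using c by (auto simp: space_PiM PiE_iff)
    qed
  qed (use finite in measurable)
  also have "\<dots> = (\<Prod>b\<in>B. emeasure lborel {- \<bar>r\<bar>..\<bar>r\<bar>})"
    using finite by (intro lborel_product.emeasure_PiM) auto
  also have "\<dots> < \<infinity>" by (simp add: ennreal_power less_top[symmetric])
  finally show ?thesis .
qed

lemma AE_span: "AE x in span_lborel B. x \<in> span B"
  unfolding span_lborel_def
proof (subst AE_distr_iff)
  show "AE c in coord_lborel B. (\<Sum>b\<in>B. c b *\<^sub>R b) \<in> span B"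
    by (intro AE_I2 span_sum span_scale span_base)
qed (simp_all add: closed_subspace borel_closed)

definition gauss :: "'a \<Rightarrow> real" where
  "gauss x = (1 / sqrt (2 * pi)) ^ card B * exp (- (norm x)\<^sup>2 / 2)"

lemma gauss_measurable [measurable]: "gauss \<in> borel_measurable borel"
  unfolding gauss_def by measurable

lemma gauss_pos: "gauss x > 0"
  by (simp add: gauss_def)

lemma gauss_sum: "gauss (\<Sum>b\<in>B. c b *\<^sub>R b) = (\<Prod>b\<in>B. std_normal_density (c b))"
proof -
  have "- (\<Sum>b\<in>B. (c b)\<^sup>2) / 2 = (\<Sum>b\<in>B. - (c b)\<^sup>2 / 2)"
    by (simp add: sum_negf sum_divide_distrib)
  then show ?thesis
    by (simp add: gauss_def norm_sum std_normal_density_def prod_dividef power_one_over exp_sum[OF finite])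
qed

text \<open>Apart from the radial factor \<open>gauss\<close>, the integrands are homogeneous of
  degree 4, so up to a common factor these are the integrals of 1, the squared cosine and its square
  over the unit sphere of \<open>span B\<close>. \<open>A\<close> is the squared norm of the
  projection of \<open>e\<close> to that span.\<close>

lemma gauss_moments:
  fixes e :: 'a
  defines "A \<equiv> \<Sum>b\<in>B. (e \<bullet> b)\<^sup>2" and "k \<equiv> real (card B)"
  shows "(\<integral>\<^sup>+x. ennreal (gauss x * norm x ^ 4) \<partial>span_lborel B) = ennreal (k * (k + 2))"
    and "(\<integral>\<^sup>+x. ennreal (gauss x * ((norm x)\<^sup>2 * (e \<bullet> x)\<^sup>2)) \<partial>span_lborel B) = ennreal ((k + 2) * A)"
    and "(\<integral>\<^sup>+x. ennreal (gauss x * (e \<bullet> x) ^ 4) \<partial>span_lborel B) = ennreal (3 * A\<^sup>2)"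
proof -
  have e: "e \<bullet> (\<Sum>b\<in>B. c b *\<^sub>R b) = (\<Sum>b\<in>B. (e \<bullet> b) * c b)" for c
    by (simp add: inner_sum_right mult.commute)
  have n4: "norm (\<Sum>b\<in>B. c b *\<^sub>R b) ^ 4 = (\<Sum>b\<in>B. (c b)\<^sup>2)\<^sup>2" for c
    unfolding norm_sum[symmetric] by simp
  note m = gaussian_moments[OF finite, of "\<lambda>b. e \<bullet> b"]
  show "(\<integral>\<^sup>+x. ennreal (gauss x * norm x ^ 4) \<partial>span_lborel B) = ennreal (k * (k + 2))"
    "(\<integral>\<^sup>+x. ennreal (gauss x * ((norm x)\<^sup>2 * (e \<bullet> x)\<^sup>2)) \<partial>span_lborel B) = ennreal ((k + 2) * A)"
    "(\<integral>\<^sup>+x. ennreal (gauss x * (e \<bullet> x) ^ 4) \<partial>span_lborel B) = ennreal (3 * A\<^sup>2)"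
    using m unfolding A_def k_def by (simp_all add: nn_integral_span_lborel gauss_sum e n4 norm_sum)
qed

end

section \<open>Polar coordinates and comparison of sections\<close>

lemma nn_integral_inverse_power:
  fixes a :: real
  assumes a: "a > 0" and k: "k > 0"
  shows "(\<integral>\<^sup>+z. ennreal (1 / z ^ Suc k) * indicator {a..} z \<partial>lborel) = ennreal (1 / (real k * a ^ k))"
proof -
  have "(\<integral>\<^sup>+z. ennreal (1 / z ^ Suc k) * indicator {a..} z \<partial>lborel)
     = ennreal (0 - (- inverse (a ^ k) / real k))"
  proof (rule nn_integral_FTC_atLeast)
    fix z assume "a \<le> z"
    then have z: "z > 0" using a by simp
    obtain j where j: "k = Suc j" using k by (cases k) auto
    show "((\<lambda>z. - inverse (z ^ k) / real k) has_real_derivative 1 / z ^ Suc k) (at z)"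
      using z unfolding j
      by (auto intro!: derivative_eq_intros simp del: of_nat_Suc power_Suc) (simp add: field_simps del: of_nat_Suc)
    show "0 \<le> 1 / z ^ Suc k" using z by simp
  next
    have "((\<lambda>z::real. inverse (z ^ k)) \<longlongrightarrow> 0) at_top"
      using k by (intro tendsto_inverse_0_at_top filterlim_pow_at_top filterlim_ident) auto
    then show "((\<lambda>z. - inverse (z ^ k) / real k) \<longlongrightarrow> 0) at_top"
      using tendsto_divide[OF tendsto_minus tendsto_const, of "\<lambda>z. inverse (z ^ k)" 0 at_top "real k"] k by simp
  qed simp
  then show ?thesis by (simp add: inverse_eq_divide mult.commute)
qed

context orthonormal_set
begin

text \<open>The dilation by 2 fixes the origin and multiplies masses by
  \<open>2 ^ card B > 1\<close>, so a finite mass at the origin must be 0.\<close>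

lemma span_lborel_null_0:
  assumes "B \<noteq> {}"
  shows "emeasure (span_lborel B) {0} = 0"
proof -
  let ?m = "emeasure (span_lborel B) {0}"
  have "?m = (\<integral>\<^sup>+x. indicator {0} x \<partial>span_lborel B)" by simp
  also have "\<dots> = ennreal (2 ^ card B) * (\<integral>\<^sup>+x. indicator {0} (2 *\<^sub>R x) \<partial>span_lborel B)"
    by (intro nn_integral_span_lborel_scale finite) auto
  also have "(\<lambda>x. indicator {0} (2 *\<^sub>R x) :: ennreal) = indicator {0 :: 'a}"
    by (auto simp: indicator_def)
  finally have m: "?m = ennreal (2 ^ card B) * ?m" by simp
  obtain r where r: "?m = ennreal r" "r \<ge> 0"
    using emeasure_cball_finite[of 0] by (cases ?m) auto
  have "(2::real) ^ card B > 1" using assms finite by (simp add: card_gt_0_iff one_less_power)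
  moreover have "r = 2 ^ card B * r" using m r by (simp flip: ennreal_mult)
  ultimately show ?thesis using r by auto
qed

text \<open>Any unit vector may stand in for the chosen element of \<open>B\<close>, since \<open>gauss\<close> is radial.\<close>

definition radial_mass :: ennreal where
  "radial_mass = (\<integral>\<^sup>+v. ennreal (v ^ (card B - 1) * (gauss (v *\<^sub>R (SOME b. b \<in> B)) * v ^ 4)) * indicator {0<..} v \<partial>lborel)"

lemma gauss_norm: "norm x = norm y \<Longrightarrow> gauss x = gauss y"
  by (simp add: gauss_def)

text \<open>
  Polar coordinates in disguise: the mass of a star body is a weighted integral of the power
  \<open>(norm x / N x) ^ card B\<close> of its radial function.  Inserting the dilations by \<open>z > 0\<close> and
  exchanging the two integrals avoids the surface measure on the sphere.
\<close>

lemma emeasure_star_body: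
  assumes B: "B \<noteq> {}" and [measurable]: "N \<in> borel_measurable borel"
    and hom: "\<And>r x. r > 0 \<Longrightarrow> N (r *\<^sub>R x) = r * N x" and pos: "\<And>x. x \<noteq> 0 \<Longrightarrow> N x > 0"
  shows "radial_mass * emeasure (span_lborel B) {x. N x \<le> 1}
    = (\<integral>\<^sup>+x. ennreal (gauss x * norm x ^ 4 * (norm x / N x) ^ card B / card B) \<partial>span_lborel B)"
proof -
  let ?M = "span_lborel B"
  define k where "k = card B"
  have k: "k > 0" using B finite by (simp add: k_def card_gt_0_iff)
  then obtain j where j: "k = Suc j" by (cases k) auto
  define d where "d = (SOME b. b \<in> B)"
  have d: "norm d = 1" using B unit by (simp add: d_def some_in_eq)
  interpret M: sigma_finite_measure ?M 
    by (intro sigma_finite_span_lborel finite emeasure_cball_finite)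
  interpret MP: pair_sigma_finite ?M lborel ..
  have ne: "AE x in ?M. x \<noteq> 0"
    by (rule AE_I[where N = "{0}"]) (auto simp: span_lborel_null_0[OF B])
  \<comment> \<open>The substitution \<open>v = norm x * z\<close> turns the radial mass into an
    integral over the dilates \<open>z *\<^sub>R x\<close> of any nonzero \<open>x\<close>.\<close>
  have mass: "radial_mass = (\<integral>\<^sup>+z. ennreal (norm x ^ k * z ^ (k - 1) * (gauss (z *\<^sub>R x) * norm (z *\<^sub>R x) ^ 4)) * indicator {0<..} z \<partial>lborel)"
    if x: "x \<noteq> 0" for x
  proof -
    have "radial_mass = ennreal (norm x) * (\<integral>\<^sup>+z. ennreal ((norm x * z) ^ (k - 1) * (gauss ((norm x * z) *\<^sub>R d) * (norm x * z) ^ 4)) * indicator {0<..} (norm x * z) \<partial>lborel)"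
      unfolding radial_mass_def k_def d_def using x by (intro nn_integral_lborel_scale) auto
    also have "\<dots> = (\<integral>\<^sup>+z. ennreal (norm x) * (ennreal ((norm x * z) ^ (k - 1) * (gauss ((norm x * z) *\<^sub>R d) * (norm x * z) ^ 4)) * indicator {0<..} (norm x * z)) \<partial>lborel)"
      by (rule nn_integral_cmult[symmetric]) measurable
    also have "\<dots> = (\<integral>\<^sup>+z. ennreal (norm x ^ k * z ^ (k - 1) * (gauss (z *\<^sub>R x) * norm (z *\<^sub>R x) ^ 4)) * indicator {0<..} z \<partial>lborel)"
    proof (intro nn_integral_cong)
      fix z :: real
      have "gauss ((norm x * z) *\<^sub>R d) = gauss (z *\<^sub>R x)" 
        by (rule gauss_norm) (simp add: d abs_mult)
      moreover have "norm (z *\<^sub>R x) ^ 4 = (norm x * z) ^ 4"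
        by (simp add: power_mult_distrib)
      ultimately show "ennreal (norm x) * (ennreal ((norm x * z) ^ (k - 1) * (gauss ((norm x * z) *\<^sub>R d) * (norm x * z) ^ 4)) * indicator {0<..} (norm x * z))
        = ennreal (norm x ^ k * z ^ (k - 1) * (gauss (z *\<^sub>R x) * norm (z *\<^sub>R x) ^ 4)) * indicator {0<..} z"
        using x by (auto simp: indicator_def zero_less_mult_iff j power_mult_distrib mult_ac simp flip: ennreal_mult')
    qed
    finally show ?thesis .
  qed
  have "radial_mass * emeasure ?M {x. N x \<le> 1} = (\<integral>\<^sup>+x. radial_mass * indicator {x. N x \<le> 1} x \<partial>?M)"
    by (subst nn_integral_cmult_indicator) auto
  also have "\<dots> = (\<integral>\<^sup>+x. \<integral>\<^sup>+z. ennreal (norm x ^ k * z ^ (k - 1) * (gauss (z *\<^sub>R x) * norm (z *\<^sub>R x) ^ 4)) * indicator {0<..} z * indicator {x. N x \<le> 1} x \<partial>lborel \<partial>?M)"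
    by (rule nn_integral_cong_AE, use ne in eventually_elim)
      (subst nn_integral_multc, auto simp: mass)
  also have "\<dots> = (\<integral>\<^sup>+z. \<integral>\<^sup>+x. ennreal (norm x ^ k * z ^ (k - 1) * (gauss (z *\<^sub>R x) * norm (z *\<^sub>R x) ^ 4)) * indicator {0<..} z * indicator {x. N x \<le> 1} x \<partial>?M \<partial>lborel)"
    by (rule MP.Fubini'[symmetric]) measurable
  also have "\<dots> = (\<integral>\<^sup>+z. \<integral>\<^sup>+x. ennreal (gauss x * norm x ^ 4 * norm x ^ k * (1 / z ^ Suc k)) * indicator {0<..} z * indicator {N x..} z \<partial>?M \<partial>lborel)"
  proof (rule nn_integral_cong)
    fix z :: real
    show "(\<integral>\<^sup>+x. ennreal (norm x ^ k * z ^ (k - 1) * (gauss (z *\<^sub>R x) * norm (z *\<^sub>R x) ^ 4)) * indicator {0<..} z * indicator {x. N x \<le> 1} x \<partial>?M)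
      = (\<integral>\<^sup>+x. ennreal (gauss x * norm x ^ 4 * norm x ^ k * (1 / z ^ Suc k)) * indicator {0<..} z * indicator {N x..} z \<partial>?M)"
    proof (cases "z > 0")
      case True
      let ?h = "\<lambda>x. ennreal (norm x ^ k * z ^ (k - 1) * (gauss (z *\<^sub>R x) * norm (z *\<^sub>R x) ^ 4)) * indicator {0<..} z * indicator {x. N x \<le> 1} x"
      \<comment> \<open>For fixed \<open>z\<close>, replacing \<open>x\<close> by
        \<open>x / z\<close> moves the dilation from \<open>gauss\<close> to the body: the condition
        becomes \<open>N x \<le> z\<close>.\<close>
      have "(\<integral>\<^sup>+x. ?h x \<partial>?M) = ennreal ((1 / z) ^ k) * (\<integral>\<^sup>+x. ?h ((1 / z) *\<^sub>R x) \<partial>?M)"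
        unfolding k_def using True by (intro nn_integral_span_lborel_scale finite) auto
      also have "\<dots> = (\<integral>\<^sup>+x. ennreal ((1 / z) ^ k) * ?h ((1 / z) *\<^sub>R x) \<partial>?M)"
        by (rule nn_integral_cmult[symmetric]) measurable
      also have "\<dots> = (\<integral>\<^sup>+x. ennreal (gauss x * norm x ^ 4 * norm x ^ k * (1 / z ^ Suc k)) * indicator {0<..} z * indicator {N x..} z \<partial>?M)"
      proof (rule nn_integral_cong)
        fix x
        have "(1 / z) ^ k * (norm ((1 / z) *\<^sub>R x) ^ k * z ^ (k - 1) * (gauss x * norm x ^ 4))
           = gauss x * norm x ^ 4 * norm x ^ k * (1 / z ^ Suc k)"
          using True by (simp add: j power_mult_distrib power_divide field_simps)
        moreover have "indicator {x. N x \<le> 1} ((1 / z) *\<^sub>R x) = (indicator {N x..} z :: ennreal)"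
          using True by (simp add: indicator_def hom[of "1 / z" x, simplified] field_simps)
        ultimately show "ennreal ((1 / z) ^ k) * ?h ((1 / z) *\<^sub>R x)
          = ennreal (gauss x * norm x ^ 4 * norm x ^ k * (1 / z ^ Suc k)) * indicator {0<..} z * indicator {N x..} z"
          using True by (simp flip: ennreal_mult' mult.assoc)
      qed
      finally show ?thesis .
    qed auto
  qed
  also have "\<dots> = (\<integral>\<^sup>+x. \<integral>\<^sup>+z. ennreal (gauss x * norm x ^ 4 * norm x ^ k * (1 / z ^ Suc k)) * indicator {0<..} z * indicator {N x..} z \<partial>lborel \<partial>?M)"
  proof (rule MP.Fubini')
    have [measurable]: "Measurable.pred (?M \<Otimes>\<^sub>M lborel) (\<lambda>p. snd p \<in> {N (fst p)..})"
      unfolding atLeast_iff by measurable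
    show "(\<lambda>(x, z). ennreal (gauss x * norm x ^ 4 * norm x ^ k * (1 / z ^ Suc k)) * indicator {0<..} z * indicator {N x..} z)
      \<in> borel_measurable (?M \<Otimes>\<^sub>M lborel)"
      unfolding case_prod_beta by measurable
  qed
  \<comment> \<open>What remains in \<open>z\<close> is the integral of \<open>1 / z ^ Suc k\<close>
    from \<open>N x\<close> on, which produces the power of the radial function.\<close>
  also have "\<dots> = (\<integral>\<^sup>+x. ennreal (gauss x * norm x ^ 4 * (norm x / N x) ^ k / k) \<partial>?M)"
  proof (rule nn_integral_cong_AE, use ne in eventually_elim)
    fix x :: 'a assume x: "x \<noteq> 0"
    have "(\<integral>\<^sup>+z. ennreal (gauss x * norm x ^ 4 * norm x ^ k * (1 / z ^ Suc k)) * indicator {0<..} z * indicator {N x..} z \<partial>lborel)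
      = (\<integral>\<^sup>+z. ennreal (gauss x * norm x ^ 4 * norm x ^ k) * (ennreal (1 / z ^ Suc k) * indicator {N x..} z) \<partial>lborel)"
      using pos[OF x] gauss_pos[of x] by (intro nn_integral_cong) (auto simp: indicator_def simp flip: ennreal_mult')
    also have "\<dots> = ennreal (gauss x * norm x ^ 4 * norm x ^ k) * ennreal (1 / (k * N x ^ k))"
      using pos[OF x] k by (subst nn_integral_cmult) (auto simp: nn_integral_inverse_power simp del: power_Suc)
    also have "\<dots> = ennreal (gauss x * norm x ^ 4 * (norm x / N x) ^ k / k)"
      using gauss_pos[of x] by (subst ennreal_mult'[symmetric]) (simp_all add: power_divide less_imp_le mult.commute[of "real k"])
    finally show "(\<integral>\<^sup>+z. ennreal (gauss x * norm x ^ 4 * norm x ^ k * (1 / z ^ Suc k)) * indicator {0<..} z * indicator {N x..} z \<partial>lborel)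
      = ennreal (gauss x * norm x ^ 4 * (norm x / N x) ^ k / k)" .
  qed
  finally show ?thesis by (simp add: k_def)
qed

text \<open>For the Euclidean ball the product with the radial mass is \<open>card B + 2\<close> by
  the Gaussian moments. A mass of 0 would make it 0, an infinite one 0 or infinite. Hence the radial
  mass can be cancelled when two bodies are compared.\<close>

lemma radial_mass_finite_pos:
  assumes "B \<noteq> {}"
  shows "radial_mass \<noteq> 0" "radial_mass < \<infinity>"
proof -
  have k: "real (card B) > 0" using assms finite by (simp add: card_gt_0_iff)
  have "radial_mass * emeasure (span_lborel B) {x. norm x \<le> 1}
    = (\<integral>\<^sup>+x. ennreal (gauss x * norm x ^ 4 * (norm x / norm x) ^ card B / card B) \<partial>span_lborel B)"
    using assms by (intro emeasure_star_body) auto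
  also have "\<dots> = (\<integral>\<^sup>+x. ennreal (1 / card B) * ennreal (gauss x * norm x ^ 4) \<partial>span_lborel B)"
    using k by (intro nn_integral_cong) (auto simp: less_imp_le[OF gauss_pos] simp flip: ennreal_mult)
  also have "\<dots> = ennreal (1 / card B) * ennreal (real (card B) * (real (card B) + 2))"
    using gauss_moments(1) by (subst nn_integral_cmult) auto
  also have "\<dots> = ennreal (real (card B) + 2)"
    using k by (simp flip: ennreal_mult)
  finally have *: "radial_mass * emeasure (span_lborel B) {x. norm x \<le> 1} = ennreal (real (card B) + 2)" .
  show "radial_mass \<noteq> 0" using * k by auto
  show "radial_mass < \<infinity>" using * k by (cases "radial_mass = \<infinity>") (auto simp: less_top ennreal_top_mult simp del: ennreal_plus split: if_splits)
qed


text \<open>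
  The hypothesis \<open>ineq\<close> says that the difference of the powers of the radial functions is at least
  \<open>\<eta> * F\<close> for \<open>F u = 1 - 2 * k * u\<^sup>2 + k * (k + 2) / 3 * u ^ 4\<close>.  The integral of \<open>F\<close> over the unit
  sphere of a \<open>k\<close>-dimensional subspace is a positive multiple of \<open>(1 - \<tau>\<^sup>2)\<^sup>2\<close>, where \<open>\<tau>\<close> is the norm
  of the projection of \<open>e\<close> to that subspace.
\<close>

lemma emeasure_gauge_mono:
  fixes e :: 'a and p q :: "real \<Rightarrow> real"
  defines "k \<equiv> real (card B)"
  assumes B: "B \<noteq> {}" and e: "norm e = 1"
    and p: "continuous_on UNIV p" "\<And>u. \<bar>u\<bar> \<le> 1 \<Longrightarrow> p u > 0"
    and q: "continuous_on UNIV q" "\<And>u. \<bar>u\<bar> \<le> 1 \<Longrightarrow> q u > 0"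
    and \<eta>: "\<eta> \<ge> 0"
    and ineq: "\<And>u. \<bar>u\<bar> \<le> 1 \<Longrightarrow> (1 / p u) ^ card B + \<eta> * (1 + k * (k + 2) / 3 * u ^ 4)
       \<le> (1 / q u) ^ card B + \<eta> * (2 * k * u\<^sup>2)"
  shows "emeasure (span_lborel B) {x. axial_gauge e p x \<le> 1} \<le> emeasure (span_lborel B) {x. axial_gauge e q x \<le> 1}"
proof -
  let ?M = "span_lborel B"
  define A where "A = (\<Sum>b\<in>B. (e \<bullet> b)\<^sup>2)"
  have A: "A \<ge> 0" by (simp add: A_def sum_nonneg)
  have k: "k > 0" using B finite by (simp add: k_def card_gt_0_iff)
  have meas: "axial_gauge e r \<in> borel_measurable borel" if "continuous_on UNIV r" for r
    using borel_measurable_continuous_onI[OF that] unfolding axial_gauge_def by measurable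
  note [measurable] = meas[OF p(1)] meas[OF q(1)]
  have pos: "axial_gauge e r x > 0" if "\<And>u. \<bar>u\<bar> \<le> 1 \<Longrightarrow> r u > 0" "x \<noteq> 0" for r x
    unfolding axial_gauge_def using that(1)[OF cosine_le_1[OF e]] that(2) by simp
  define I where "I r = (\<integral>\<^sup>+x. ennreal (gauss x * norm x ^ 4 * (norm x / axial_gauge e r x) ^ card B / k) \<partial>?M)" for r
  have mass: "radial_mass * emeasure ?M {x. axial_gauge e r x \<le> 1} = I r"
    if "continuous_on UNIV r" "\<And>u. \<bar>u\<bar> \<le> 1 \<Longrightarrow> r u > 0" for r
    unfolding I_def k_def
    by (intro emeasure_star_body B meas[OF that(1)] axial_gauge_scaleR pos[OF that(2)])
  have g0: "gauss x \<ge> 0" for x using gauss_pos[of x] by simp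
  \<comment> \<open>This is \<open>ineq\<close> at the cosine belonging to \<open>x\<close>,
    multiplied by the weight \<open>gauss x * norm x ^ 4 / k\<close>. Negative terms stand on the
    opposite side, so that all integrals can be taken in \<open>ennreal\<close>.\<close>
  have pw: "gauss x * norm x ^ 4 * (norm x / axial_gauge e p x) ^ card B / k
      + (\<eta> / k * (gauss x * norm x ^ 4) + \<eta> * (k + 2) / 3 * (gauss x * (e \<bullet> x) ^ 4))
    \<le> gauss x * norm x ^ 4 * (norm x / axial_gauge e q x) ^ card B / k
      + 2 * \<eta> * (gauss x * ((norm x)\<^sup>2 * (e \<bullet> x)\<^sup>2))" for x
  proof (cases "x = 0")
    case False
    define u where "u = e \<bullet> x / norm x"
    have u: "\<bar>u\<bar> \<le> 1" unfolding u_def by (rule cosine_le_1[OF e])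
    have ex: "e \<bullet> x = norm x * u" using False by (simp add: u_def)
    have r: "norm x / axial_gauge e r x = 1 / r u" for r
      using False by (simp add: axial_gauge_def u_def)
    have "gauss x * norm x ^ 4 / k * ((1 / p u) ^ card B + \<eta> * (1 + k * (k + 2) / 3 * u ^ 4))
      \<le> gauss x * norm x ^ 4 / k * ((1 / q u) ^ card B + \<eta> * (2 * k * u\<^sup>2))"
      using g0[of x] k u by (intro mult_left_mono ineq) auto
    moreover have "gauss x * norm x ^ 4 / k * (P + \<eta> * (1 + k * (k + 2) / 3 * u ^ 4))
      = gauss x * norm x ^ 4 * P / k
      + (\<eta> / k * (gauss x * norm x ^ 4) + \<eta> * (k + 2) / 3 * (gauss x * (e \<bullet> x) ^ 4))" for P
      using k by (simp add: ex field_simps)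
    moreover have "gauss x * norm x ^ 4 / k * (P + \<eta> * (2 * k * u\<^sup>2))
      = gauss x * norm x ^ 4 * P / k + 2 * \<eta> * (gauss x * ((norm x)\<^sup>2 * (e \<bullet> x)\<^sup>2))" for P
      using k by (simp add: ex field_simps power2_eq_square power4_eq_xxxx)
    ultimately show ?thesis unfolding r by metis
  qed simp
  have star0: "0 \<le> gauss x * norm x ^ 4 * (norm x / axial_gauge e r x) ^ card B / k" 
    if "\<And>u. \<bar>u\<bar> \<le> 1 \<Longrightarrow> r u > 0" for r x
    using pos[where r = r and x = x] that g0[of x] k by (cases "x = 0") (auto intro!: divide_nonneg_pos mult_nonneg_nonneg zero_le_power divide_nonneg_nonneg)
  have lin: "(\<integral>\<^sup>+x. ennreal (f x + (a * g x + b * h x)) \<partial>?M) = (\<integral>\<^sup>+x. ennreal (f x) \<partial>?M)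
      + (ennreal a * (\<integral>\<^sup>+x. ennreal (g x) \<partial>?M) + ennreal b * (\<integral>\<^sup>+x. ennreal (h x) \<partial>?M))"
    if [measurable]: "f \<in> borel_measurable borel" "g \<in> borel_measurable borel" "h \<in> borel_measurable borel"
      and "\<And>x. 0 \<le> f x" "\<And>x. 0 \<le> g x" "\<And>x. 0 \<le> h x" "0 \<le> a" "0 \<le> b"
    for f g h :: "'a \<Rightarrow> real" and a b
    using that(4-) by (simp add: ennreal_mult nn_integral_add nn_integral_cmult)
  have "I p + (ennreal (\<eta> / k) * ennreal (k * (k + 2)) + ennreal (\<eta> * (k + 2) / 3) * ennreal (3 * A\<^sup>2))
    = (\<integral>\<^sup>+x. ennreal (gauss x * norm x ^ 4 * (norm x / axial_gauge e p x) ^ card B / k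
      + (\<eta> / k * (gauss x * norm x ^ 4) + \<eta> * (k + 2) / 3 * (gauss x * (e \<bullet> x) ^ 4))) \<partial>?M)"
    unfolding I_def k_def A_def gauss_moments[symmetric]
    using \<eta> star0[where r = p, OF p(2), unfolded k_def]
    by (intro lin[symmetric]) (measurable, auto intro!: mult_nonneg_nonneg g0 zero_le_even_power)
  also have "\<dots> \<le> (\<integral>\<^sup>+x. ennreal (gauss x * norm x ^ 4 * (norm x / axial_gauge e q x) ^ card B / k
      + 2 * \<eta> * (gauss x * ((norm x)\<^sup>2 * (e \<bullet> x)\<^sup>2))) \<partial>?M)"
    by (intro nn_integral_mono ennreal_leI pw)
  also have "\<dots> = (\<integral>\<^sup>+x. ennreal (gauss x * norm x ^ 4 * (norm x / axial_gauge e q x) ^ card B / k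
      + (2 * \<eta> * (gauss x * ((norm x)\<^sup>2 * (e \<bullet> x)\<^sup>2)) + 0 * 0)) \<partial>?M)"
    by simp
  also have "\<dots> = I q + (ennreal (2 * \<eta>) * ennreal ((k + 2) * A) + ennreal 0 * (\<integral>\<^sup>+x. ennreal 0 \<partial>?M))"
    unfolding I_def k_def A_def gauss_moments[symmetric]
    using \<eta> star0[where r = q, OF q(2), unfolded k_def]
    by (intro lin) (measurable, auto intro!: mult_nonneg_nonneg g0)
  also have "\<dots> = I q + ennreal (2 * \<eta>) * ennreal ((k + 2) * A)" by simp
  also have "ennreal (2 * \<eta>) * ennreal ((k + 2) * A) = ennreal (2 * \<eta> * ((k + 2) * A))"
    using \<eta> k A by (simp flip: ennreal_mult)
  \<comment> \<open>The right side exceeds the left by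
    \<open>\<eta> * (k + 2) * (1 - A)\<^sup>2\<close>.\<close>
  also have "\<dots> \<le> ennreal (\<eta> / k * (k * (k + 2)) + \<eta> * (k + 2) / 3 * (3 * A\<^sup>2))"
  proof (rule ennreal_leI)
    have "0 \<le> \<eta> * (k + 2) * (1 - A)\<^sup>2" using \<eta> k by simp
    then have "2 * \<eta> * ((k + 2) * A) \<le> \<eta> * (k + 2) + \<eta> * (k + 2) * A\<^sup>2"
      by (simp add: power2_eq_square algebra_simps)
    then show "2 * \<eta> * ((k + 2) * A) \<le> \<eta> / k * (k * (k + 2)) + \<eta> * (k + 2) / 3 * (3 * A\<^sup>2)"
      using k by simp
  qed
  finally have "I p + ennreal (\<eta> / k * (k * (k + 2)) + \<eta> * (k + 2) / 3 * (3 * A\<^sup>2))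
     \<le> I q + ennreal (\<eta> / k * (k * (k + 2)) + \<eta> * (k + 2) / 3 * (3 * A\<^sup>2))"
    using \<eta> k by (simp add: add_left_mono flip: ennreal_mult ennreal_plus)
  then have "I p \<le> I q" 
    by (simp add: add.commute[of "I _"] ennreal_add_left_cancel_le del: ennreal_plus)
  then have "radial_mass * emeasure ?M {x. axial_gauge e p x \<le> 1} \<le> radial_mass * emeasure ?M {x. axial_gauge e q x \<le> 1}"
    by (simp add: mass p q)
  then show ?thesis
    using radial_mass_finite_pos[OF B] by (simp add: ennreal_mult_le_mult_iff less_top)
qed

end

section \<open>Profile integrals\<close>

text \<open>For a vector of slope \<open>w\<close> over the hyperplane orthogonal to \<open>e\<close>, the sine and cosine of its angle with \<open>e\<close>.\<close>

definition sine :: "real \<Rightarrow> real" where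
  "sine w = 1 / sqrt (1 + w\<^sup>2)"

definition cosine :: "real \<Rightarrow> real" where
  "cosine w = w * sine w"

text \<open>The gauge of the cylinder of radius 1 and half-height 3 about \<open>e\<close>, as a function of the cosine of the angle with \<open>e\<close>.\<close>

definition cyl :: "real \<Rightarrow> real" where
  "cyl u = max (sqrt (1 - u\<^sup>2)) (\<bar>u\<bar> / 3)"

text \<open>The coefficients are those for which the integrals over unit spheres of
  \<open>m\<close>-dimensional subspaces form a perfect square, vanishing exactly when the subspace
  contains the axis.\<close>

definition quartic :: "real \<Rightarrow> real \<Rightarrow> real" where
  "quartic m u = 1 - 2 * m * u\<^sup>2 + m * (m + 2) / 3 * u ^ 4"

lemma sine_pos: "0 < sine w"
  by (simp add: sine_def add_pos_nonneg)

lemma sine_power2: "(sine w)\<^sup>2 = 1 / (1 + w\<^sup>2)"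
  by (simp add: sine_def power_divide)

lemma one_plus_power2_pos: "0 < 1 + (w::real)\<^sup>2"
  by (simp add: add_pos_nonneg)

lemma sine_cosine: "(sine w)\<^sup>2 + (cosine w)\<^sup>2 = 1"
  using one_plus_power2_pos[of w] unfolding cosine_def power_mult_distrib sine_power2 by (simp add: field_simps)

lemma sine_le_1: "sine w \<le> 1"
proof -
  have "(sine w)\<^sup>2 \<le> 1" using sine_cosine[of w] zero_le_power2[of "cosine w"] by linarith
  then show ?thesis by (simp add: abs_square_le_1 abs_le_iff)
qed

lemma abs_cosine_le_1: "\<bar>cosine w\<bar> \<le> 1"
proof -
  have "(cosine w)\<^sup>2 \<le> 1" using sine_cosine[of w] zero_le_power2[of "sine w"] by linarith
  then show ?thesis by (simp add: abs_square_le_1)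
qed

lemma sine_measurable [measurable]: "sine \<in> borel_measurable borel"
  unfolding sine_def by measurable

lemma cosine_measurable [measurable]: "cosine \<in> borel_measurable borel"
  unfolding cosine_def by measurable

lemma cyl_measurable [measurable]: "cyl \<in> borel_measurable borel"
  unfolding cyl_def by measurable

lemma cyl_cosine: "cyl (cosine w) = max 1 (\<bar>w\<bar> / 3) * sine w"
proof -
  have "sqrt (1 - (cosine w)\<^sup>2) = sine w"
    using sine_cosine[of w] sine_pos[of w] by (intro real_sqrt_unique) auto
  then show ?thesis using sine_pos[of w]
    by (simp add: cyl_def cosine_def abs_mult max_mult_distrib_right)
qed

text \<open>The minimum is \<open>1 / sqrt 10\<close>, attained at the rim, where
  \<open>u\<^sup>2 = 9 / 10\<close>; the bound is a rational number just below it.\<close>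

lemma cyl_ge:
  assumes u: "\<bar>u\<bar> \<le> 1"
  shows "cyl u \<ge> 3 / 10"
proof (cases "\<bar>u\<bar> \<ge> 9 / 10")
  case True
  then show ?thesis by (simp add: cyl_def)
next
  case False
  then have "\<bar>u\<bar>\<^sup>2 \<le> (9 / 10)\<^sup>2" by (intro power_mono) auto
  then have "3 / 10 \<le> sqrt (1 - u\<^sup>2)" by (intro real_le_rsqrt) (simp add: power2_eq_square)
  then show ?thesis by (simp add: cyl_def)
qed

text \<open>As \<open>n\<close> is at least 2, the weight is dominated by
  \<open>(sine w)\<^sup>2 = 1 / (1 + w\<^sup>2)\<close>.\<close>

lemma integrable_bounded_weight:
  fixes q :: "real \<Rightarrow> real"
  assumes n: "n \<ge> 2" and [measurable]: "q \<in> borel_measurable borel" and q: "\<And>w. \<bar>q w\<bar> \<le> C"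
  shows "integrable lborel (\<lambda>w. q w * sine w ^ n)"
proof (rule Bochner_Integration.integrable_bound)
  show "integrable lborel (\<lambda>w. C * inverse (1 + w\<^sup>2))"
    using integrable_inverse_1_plus_square by (simp add: set_integrable_def)
  show "AE w in lborel. norm (q w * sine w ^ n) \<le> norm (C * inverse (1 + w\<^sup>2))"
  proof (intro AE_I2)
    fix w :: real
    have "sine w ^ n \<le> (sine w)\<^sup>2"
      using n sine_le_1[of w] sine_pos[of w] by (intro power_decreasing) auto
    then have "\<bar>q w\<bar> * sine w ^ n \<le> C * inverse (1 + w\<^sup>2)"
      using q[of w] sine_pos[of w] by (intro mult_mono) (auto simp: sine_power2 inverse_eq_divide)
    then show "norm (q w * sine w ^ n) \<le> norm (C * inverse (1 + w\<^sup>2))"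
      using q[of w] sine_pos[of w] by (simp add: abs_mult)
  qed
qed measurable

lemma quartic_bound:
  assumes "m \<ge> 0" "\<bar>u\<bar> \<le> 1"
  shows "\<bar>quartic m u\<bar> \<le> 1 + 2 * m + m * (m + 2) / 3"
proof -
  have u2: "u\<^sup>2 \<le> 1" using assms(2) by (simp add: abs_square_le_1)
  then have u4: "u ^ 4 \<le> 1" using power_le_one[of "u\<^sup>2" 2] by simp
  have "0 \<le> 2 * m * u\<^sup>2" "2 * m * u\<^sup>2 \<le> 2 * m * 1" using assms(1) u2 by (auto intro: mult_left_le)
  moreover have "0 \<le> m * (m + 2) / 3 * u ^ 4" "m * (m + 2) / 3 * u ^ 4 \<le> m * (m + 2) / 3 * 1"
    using assms(1) u4 by (auto intro!: mult_nonneg_nonneg zero_le_even_power) (intro divide_right_mono mult_left_le; simp)+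
  ultimately show ?thesis unfolding quartic_def by linarith
qed

lemma quartic_measurable [measurable]: "quartic m \<in> borel_measurable borel"
  unfolding quartic_def by measurable

text \<open>\<open>9 / 10\<close> is the squared cosine at the rim of the cylinder, so this is
  positivity over the bases. The restriction on the dimension enters here: for \<open>m = 3\<close>
  the quartic is negative at the rim and 0 at the pole.\<close>

lemma quartic_pos:
  assumes m: "m \<ge> 4" and u: "u\<^sup>2 \<ge> 9 / 10"
  shows "quartic m u > 0"
proof -
  define v where "v = u\<^sup>2 - 9 / 10"
  have v: "v \<ge> 0" using u by (simp add: v_def)
  have u2: "u\<^sup>2 = 9 / 10 + v" by (simp add: v_def)
  have u4: "u ^ 4 = (9 / 10 + v)\<^sup>2" unfolding u2[symmetric] by simp
  have "quartic m u = (1 - 126 / 100 * m + 27 / 100 * m\<^sup>2) + (m * (3 * m / 5 - 4 / 5)) * v + m * (m + 2) / 3 * v\<^sup>2"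
    unfolding quartic_def u4 u2 by (simp add: power2_eq_square field_simps)
  moreover have "0 < 1 - 126 / 100 * m + 27 / 100 * m\<^sup>2"
  proof -
    \<comment> \<open>The constant coefficient is
      \<open>((m - 4) * (27 * m - 18) + 28) / 100\<close>.\<close>
    have "0 \<le> (m - 4) * (27 * m - 18)" using m by simp
    then show ?thesis by (simp add: power2_eq_square algebra_simps)
  qed
  moreover have "0 \<le> (m * (3 * m / 5 - 4 / 5)) * v" "0 \<le> m * (m + 2) / 3 * v\<^sup>2" using m v by auto
  ultimately show ?thesis by linarith
qed

text \<open>In terms of the slope, \<open>sine w ^ m\<close> is the weight of the invariant measure
  on the unit sphere of an \<open>m\<close>-dimensional subspace containing \<open>e\<close>, the
  case where the perfect square vanishes. The proof uses an explicit antiderivative that tends to 0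
  at both ends.\<close>

lemma integral_quartic_0:
  assumes m: "m \<ge> 2"
  shows "integrable lborel (\<lambda>w. quartic (real m) (cosine w) * sine w ^ m)"
    and "(LBINT w. quartic (real m) (cosine w) * sine w ^ m) = 0"
proof -
  \<comment> \<open>In terms of the angle, \<open>?Q\<close> is the cosine times
    \<open>sine w ^ (m - 1)\<close> times \<open>(sine w)\<^sup>2 - ?a * (cosine w)\<^sup>2\<close>.
    The value of \<open>?a\<close> comes from matching the derivative with the quartic.\<close>
  let ?a = "(real m - 3) / 3"
  let ?Q = "\<lambda>w. w * (1 - ?a * w\<^sup>2) * sine w ^ (m + 2)"
  let ?G = "\<lambda>w. quartic (real m) (cosine w) * sine w ^ m"
  show int: "integrable lborel ?G"
    by (rule integrable_bounded_weight[OF m]) (auto intro!: quartic_bound abs_cosine_le_1)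
  have deriv: "(?Q has_real_derivative ?G w) (at w)" for w
  proof -
    have p: "0 < 1 + w\<^sup>2" by (rule one_plus_power2_pos)
    have ds: "(sine has_real_derivative - w * sine w ^ 3) (at w)"
    proof -
      have "((\<lambda>w. inverse (sqrt (1 + w\<^sup>2))) has_real_derivative 
         - (inverse (sqrt (1 + w\<^sup>2)) * (2 * w * (inverse (sqrt (1 + w\<^sup>2)) / 2)) * inverse (sqrt (1 + w\<^sup>2)))) (at w)"
        using p by (auto intro!: derivative_eq_intros simp: power2_eq_square)
      then show ?thesis unfolding sine_def[abs_def] inverse_eq_divide by (simp add: power3_eq_cube)
    qed
    have "(?Q has_real_derivative ((1 - ?a * w\<^sup>2) + w * (- (?a * (2 * w)))) * sine w ^ (m + 2)
        + w * (1 - ?a * w\<^sup>2) * (real (m + 2) * sine w ^ (m + 1) * (- w * sine w ^ 3))) (at w)"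
    proof -
      have 1: "((\<lambda>w. w * (1 - a * w\<^sup>2)) has_real_derivative (1 - a * w\<^sup>2) + w * (- (a * (2 * w)))) (at w)" for a
        by (auto intro!: derivative_eq_intros simp: algebra_simps power2_eq_square)
      have 2: "((\<lambda>w. sine w ^ (m + 2)) has_real_derivative real (m + 2) * sine w ^ (m + 1) * (- w * sine w ^ 3)) (at w)"
        using DERIV_power[OF ds, of "m + 2"] by (simp add: mult_ac)
      show ?thesis 
        by (rule DERIV_cong[OF DERIV_mult[OF 1 2]], rule arg_cong2[where f = "(+)"], rule refl, rule mult.commute)
    qed
    moreover have "((1 - ?a * w\<^sup>2) + w * (- (?a * (2 * w)))) * sine w ^ (m + 2)
        + w * (1 - ?a * w\<^sup>2) * (real (m + 2) * sine w ^ (m + 1) * (- w * sine w ^ 3)) = ?G w"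
    proof -
      have "((1 - a * w\<^sup>2) + w * (- (a * (2 * w)))) * sine w ^ (m + 2)
        + w * (1 - a * w\<^sup>2) * (real (m + 2) * sine w ^ (m + 1) * (- w * sine w ^ 3))
        = ((1 - 3 * a * w\<^sup>2) * (sine w)\<^sup>2 - (real m + 2) * w\<^sup>2 * (1 - a * w\<^sup>2) * ((sine w)\<^sup>2)\<^sup>2) * sine w ^ m" for a
        by (simp add: power_add power2_eq_square power3_eq_cube algebra_simps)
      from this[of ?a] have "((1 - ?a * w\<^sup>2) + w * (- (?a * (2 * w)))) * sine w ^ (m + 2)
        + w * (1 - ?a * w\<^sup>2) * (real (m + 2) * sine w ^ (m + 1) * (- w * sine w ^ 3))
        = ((1 - 3 * ?a * w\<^sup>2) * (sine w)\<^sup>2 - (real m + 2) * w\<^sup>2 * (1 - ?a * w\<^sup>2) * ((sine w)\<^sup>2)\<^sup>2) * sine w ^ m" .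
      also have "(1 - 3 * ?a * w\<^sup>2) * (sine w)\<^sup>2 - (real m + 2) * w\<^sup>2 * (1 - ?a * w\<^sup>2) * ((sine w)\<^sup>2)\<^sup>2
        = 1 - 2 * real m * (w\<^sup>2 * (sine w)\<^sup>2) + real m * (real m + 2) / 3 * (w\<^sup>2 * (sine w)\<^sup>2)\<^sup>2"
      proof -
        define v where "v = w\<^sup>2"
        have "1 + v \<noteq> 0" using p by (simp add: v_def)
        then show ?thesis unfolding sine_power2 v_def[symmetric]
          by (simp add: divide_simps) (simp add: power2_eq_square algebra_simps)
      qed
      also have "(w\<^sup>2 * (sine w)\<^sup>2) = (cosine w)\<^sup>2" by (simp add: cosine_def power_mult_distrib)
      also have "((cosine w)\<^sup>2)\<^sup>2 = cosine w ^ 4" by simp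
      finally show ?thesis by (simp add: quartic_def)
    qed
    ultimately show ?thesis by simp
  qed
  \<comment> \<open>Three factors \<open>sine w\<close> control the cubic in \<open>w\<close>; as
    \<open>m \<ge> 2\<close>, at least one more is left and gives the decay.\<close>
  have bound: "norm (?Q w) \<le> (1 + \<bar>?a\<bar>) * inverse \<bar>w\<bar>" if "w \<noteq> 0" for w
  proof -
    have s: "0 < sine w" by (rule sine_pos)
    have ws: "\<bar>w\<bar> * sine w \<le> 1" using abs_cosine_le_1[of w] s by (simp add: cosine_def abs_mult)
    have w2: "w\<^sup>2 * (sine w)\<^sup>2 \<le> 1" using abs_cosine_le_1[of w] by (simp add: cosine_def power_mult_distrib flip: abs_square_le_1)
    have "sine w ^ (m - 1) \<le> sine w ^ 1" using m s sine_le_1 by (intro power_decreasing) auto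
    also have "\<dots> \<le> inverse \<bar>w\<bar>" using ws that by (simp add: field_simps)
    finally have 1: "sine w ^ (m - 1) \<le> inverse \<bar>w\<bar>" .
    have "\<bar>1 - ?a * w\<^sup>2\<bar> * (sine w)\<^sup>2 \<le> (1 + \<bar>?a\<bar> * w\<^sup>2) * (sine w)\<^sup>2"
      by (intro mult_right_mono order_trans[OF abs_triangle_ineq4]) (auto simp: abs_mult)
    also have "\<dots> = (sine w)\<^sup>2 + \<bar>?a\<bar> * (w\<^sup>2 * (sine w)\<^sup>2)" by (simp add: algebra_simps)
    also have "\<dots> \<le> 1 + \<bar>?a\<bar> * 1"
      using s sine_le_1[of w] w2 by (intro add_mono mult_left_mono) (auto simp: abs_square_le_1)
    finally have 2: "\<bar>1 - ?a * w\<^sup>2\<bar> * (sine w)\<^sup>2 \<le> 1 + \<bar>?a\<bar>" by simp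
    have "m + 2 = 1 + 2 + (m - 1)" using m by simp
    then have "norm (?Q w) = (\<bar>w\<bar> * sine w) * (\<bar>1 - ?a * w\<^sup>2\<bar> * (sine w)\<^sup>2) * sine w ^ (m - 1)"
      using s by (simp only: power_add) (simp add: abs_mult mult_ac)
    also have "\<dots> \<le> 1 * (1 + \<bar>?a\<bar>) * inverse \<bar>w\<bar>"
      using s by (intro mult_mono ws 1 2) auto
    finally show ?thesis by simp
  qed
  have lim: "(?Q \<longlongrightarrow> 0) F" if F: "filterlim (\<lambda>w::real. \<bar>w\<bar>) at_top F" for F
  proof (rule Lim_null_comparison)
    show "((\<lambda>w. (1 + \<bar>?a\<bar>) * inverse \<bar>w\<bar>) \<longlongrightarrow> 0) F"
      using tendsto_mult[OF tendsto_const tendsto_inverse_0_at_top[OF F], of "1 + \<bar>?a\<bar>"] by simp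
    have "\<forall>\<^sub>F w in F. 1 \<le> \<bar>w\<bar>" using F by (simp add: filterlim_at_top)
    then show "\<forall>\<^sub>F w in F. norm (?Q w) \<le> (1 + \<bar>?a\<bar>) * inverse \<bar>w\<bar>"
      by (rule eventually_mono) (rule bound, auto)
  qed
  have "(LBINT w=-\<infinity>..\<infinity>. ?G w) = 0 - 0"
  proof (rule interval_integral_FTC_integrable)
    show "set_integrable lborel (einterval (- \<infinity>) \<infinity>) ?G" using int by (simp add: set_integrable_def)
    show "((?Q \<circ> real_of_ereal) \<longlongrightarrow> 0) (at_right (- \<infinity>))"
      unfolding ereal_tendsto_simps 
      using filterlim_abs_real by (intro lim) (simp add: filterlim_at_top_mirror)
    show "((?Q \<circ> real_of_ereal) \<longlongrightarrow> 0) (at_left \<infinity>)"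
      unfolding ereal_tendsto_simps by (rule lim) (rule filterlim_abs_real)
  next
    fix w
    show "(?Q has_vector_derivative ?G w) (at w)"
      using deriv[of w] by (simp add: has_real_derivative_iff_has_vector_derivative)
    show "isCont ?G w" unfolding quartic_def cosine_def sine_def using one_plus_power2_pos[of w] 
      by (intro continuous_intros) auto
  qed simp
  then show "(LBINT w. ?G w) = 0" by (simp add: interval_lebesgue_integral_def set_lebesgue_integral_def)
qed

section \<open>Volumes\<close>

lemma lborel_eq_span_lborel: "(lborel :: 'a::euclidean_space measure) = span_lborel Basis"
  by (simp add: span_lborel_def lborel_def[where 'a = 'a] lborel_eq_real)

lemma nn_integral_span_lborel_insert:
  fixes g :: "'a::euclidean_space \<Rightarrow> ennreal"
  assumes B: "finite B" "b \<notin> B" and [measurable]: "g \<in> borel_measurable borel"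
  shows "(\<integral>\<^sup>+x. g x \<partial>span_lborel (insert b B)) = (\<integral>\<^sup>+x. \<integral>\<^sup>+y. g (x + y *\<^sub>R b) \<partial>lborel \<partial>span_lborel B)"
proof -
  have "(\<Sum>d\<in>insert b B. (c(b := y)) d *\<^sub>R d) = (\<Sum>d\<in>B. c d *\<^sub>R d) + y *\<^sub>R b" for c :: "'a \<Rightarrow> real" and y
    using B by (simp add: add.commute) (intro sum.cong, auto)
  note upd = this[simplified fun_upd_apply]
  show ?thesis
    using B by (simp add: nn_integral_span_lborel lborel_product.product_nn_integral_insert upd del: sum.insert)
qed

lemma orthonormal_set_subset_Basis: "B \<subseteq> Basis \<Longrightarrow> orthonormal_set B"
  by unfold_locales (auto simp: pairwise_def orthogonal_def inner_not_same_Basis subset_iff)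

text \<open>Cylindrical coordinates: a point is \<open>x + (norm x * w) *\<^sub>R e\<close> with
  \<open>x\<close> orthogonal to \<open>e\<close>. For a fixed slope \<open>w\<close> the body
  bounds \<open>norm x\<close> by \<open>sine w / p (cosine w)\<close>; scaling in the hyperplane
  gives the power \<open>DIM('a) - 1\<close> of this bound, and the Jacobian \<open>norm x\<close>
  one more. As \<open>C\<close> is independent of \<open>p\<close>, volumes can be compared through
  the profile integrals.\<close>

lemma emeasure_axial_gauge:
  fixes e :: "'a::euclidean_space"
  assumes e: "e \<in> Basis" and dim: "DIM('a) \<ge> 2"
  obtains C :: real where "C > 0"
    and "\<And>p. continuous_on UNIV p \<Longrightarrow> (\<And>u. \<bar>u\<bar> \<le> 1 \<Longrightarrow> p u > 0) \<Longrightarrow>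
      emeasure lborel {x :: 'a. axial_gauge e p x \<le> 1}
        = ennreal C * (\<integral>\<^sup>+w. ennreal ((sine w / p (cosine w)) ^ DIM('a)) \<partial>lborel)"
proof -
  define B where "B = Basis - {e}"
  interpret orthonormal_set B by (rule orthonormal_set_subset_Basis) (auto simp: B_def)
  have insB: "insert e B = Basis" and eB: "e \<notin> B" using e by (auto simp: B_def)
  have card: "DIM('a) = Suc (card B)" using insB eB finite by (metis card_insert_disjoint)
  then have ne: "B \<noteq> {}" using dim finite by (auto simp: card_gt_0_iff)
  let ?M = "span_lborel B"
  interpret M: sigma_finite_measure ?M 
    by (intro sigma_finite_span_lborel finite emeasure_cball_finite)
  interpret MP: pair_sigma_finite ?M lborel ..
  have [measurable]: "cball (0::'a) 1 \<in> sets borel" by simp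
  define C where "C = (\<integral>\<^sup>+x. ennreal (norm x) * indicator (cball 0 1) x \<partial>?M)"
  have perp: "AE x in ?M. x \<noteq> 0 \<and> e \<bullet> x = 0"
  proof -
    have "AE x in ?M. x \<noteq> 0"
      by (rule AE_I[where N = "{0}"]) (auto simp: span_lborel_null_0[OF ne])
    moreover have "e \<bullet> x = 0" if "x \<in> span B" for x
      using that e by (intro orthogonal_to_span[unfolded orthogonal_def, of x B e])
        (auto simp: B_def inner_Basis)
    then have "AE x in ?M. e \<bullet> x = 0" using AE_span by (auto elim: eventually_mono)
    ultimately show ?thesis by eventually_elim simp
  qed
  have main: "emeasure lborel {x :: 'a. axial_gauge e p x \<le> 1}
        = C * (\<integral>\<^sup>+w. ennreal ((sine w / p (cosine w)) ^ DIM('a)) \<partial>lborel)"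
    if p: "continuous_on UNIV p" "\<And>u. \<bar>u\<bar> \<le> 1 \<Longrightarrow> p u > 0" for p
  proof -
    define D where "D w = p (cosine w) / sine w" for w
    have D: "D w > 0" for w unfolding D_def by (intro divide_pos_pos p sine_pos abs_cosine_le_1)
    have [measurable]: "p \<in> borel_measurable borel" 
      using p(1) by (rule borel_measurable_continuous_onI)
    have [measurable]: "axial_gauge e p \<in> borel_measurable borel"
      unfolding axial_gauge_def by measurable
    have [measurable]: "D \<in> borel_measurable borel" unfolding D_def by measurable
    have gauge_D: "axial_gauge e p (x + (norm x * w) *\<^sub>R e) = norm x * D w" if "x \<noteq> 0" "e \<bullet> x = 0" for x w
    proof -
      have "(norm (x + (norm x * w) *\<^sub>R e))\<^sup>2 = (norm x)\<^sup>2 + (norm x * w)\<^sup>2"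
        using that e by (simp add: norm_add_Pythagorean orthogonal_def inner_commute abs_mult power_mult_distrib)
      also have "\<dots> = (norm x * sqrt (1 + w\<^sup>2))\<^sup>2" by (simp add: power_mult_distrib distrib_left)
      finally have n: "norm (x + (norm x * w) *\<^sub>R e) = norm x * sqrt (1 + w\<^sup>2)"
        by (rule power2_eq_imp_eq) auto
      have "e \<bullet> (x + (norm x * w) *\<^sub>R e) = norm x * w" using that e by (simp add: inner_add_right)
      then show ?thesis using that(1) by (simp add: axial_gauge_def D_def n cosine_def sine_def)
    qed
    have "emeasure lborel {x :: 'a. axial_gauge e p x \<le> 1} 
      = (\<integral>\<^sup>+x. indicator {x. axial_gauge e p x \<le> 1} x \<partial>span_lborel (insert e B))"
      by (simp add: insB flip: lborel_eq_span_lborel)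
    also have "\<dots> = (\<integral>\<^sup>+x. \<integral>\<^sup>+y. indicator {x. axial_gauge e p x \<le> 1} (x + y *\<^sub>R e) \<partial>lborel \<partial>?M)"
      by (rule nn_integral_span_lborel_insert) (auto simp: finite eB)
    also have "\<dots> = (\<integral>\<^sup>+x. \<integral>\<^sup>+w. ennreal (norm x) * indicator {..1 / D w} (norm x) \<partial>lborel \<partial>?M)"
    proof (rule nn_integral_cong_AE, use perp in eventually_elim)
      fix x assume x: "x \<noteq> 0 \<and> e \<bullet> x = 0"
      have "(\<integral>\<^sup>+y. indicator {x. axial_gauge e p x \<le> 1} (x + y *\<^sub>R e) \<partial>lborel)
        = ennreal (norm x) * (\<integral>\<^sup>+w. indicator {x. axial_gauge e p x \<le> 1} (x + (norm x * w) *\<^sub>R e) \<partial>lborel)"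
        using x by (intro nn_integral_lborel_scale) auto
      also have "\<dots> = (\<integral>\<^sup>+w. ennreal (norm x) * indicator {x. axial_gauge e p x \<le> 1} (x + (norm x * w) *\<^sub>R e) \<partial>lborel)"
        by (rule nn_integral_cmult[symmetric]) measurable
      also have "\<dots> = (\<integral>\<^sup>+w. ennreal (norm x) * indicator {..1 / D w} (norm x) \<partial>lborel)"
        using x D by (intro nn_integral_cong) (auto simp: indicator_def gauge_D pos_le_divide_eq not_le)
      finally show "(\<integral>\<^sup>+y. indicator {x. axial_gauge e p x \<le> 1} (x + y *\<^sub>R e) \<partial>lborel)
        = (\<integral>\<^sup>+w. ennreal (norm x) * indicator {..1 / D w} (norm x) \<partial>lborel)" .
    qed
    also have "\<dots> = (\<integral>\<^sup>+w. \<integral>\<^sup>+x. ennreal (norm x) * indicator {..1 / D w} (norm x) \<partial>?M \<partial>lborel)"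
    proof (rule MP.Fubini'[symmetric])
      have [measurable]: "Measurable.pred (?M \<Otimes>\<^sub>M lborel) (\<lambda>z. norm (fst z) \<in> {..1 / D (snd z)})"
        unfolding atMost_iff by measurable
      show "(\<lambda>(x, w). ennreal (norm x) * indicator {..1 / D w} (norm x)) \<in> borel_measurable (?M \<Otimes>\<^sub>M lborel)"
        unfolding case_prod_beta by measurable
    qed
    also have "\<dots> = (\<integral>\<^sup>+w. ennreal ((1 / D w) ^ DIM('a)) * C \<partial>lborel)"
    proof (rule nn_integral_cong)
      fix w
      have "(\<integral>\<^sup>+x. ennreal (norm x) * indicator {..1 / D w} (norm x) \<partial>?M)
        = ennreal ((1 / D w) ^ card B) * (\<integral>\<^sup>+x. ennreal (norm ((1 / D w) *\<^sub>R x)) * indicator {..1 / D w} (norm ((1 / D w) *\<^sub>R x)) \<partial>?M)"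
        using D by (intro nn_integral_span_lborel_scale finite) auto
      also have "(\<integral>\<^sup>+x. ennreal (norm ((1 / D w) *\<^sub>R x)) * indicator {..1 / D w} (norm ((1 / D w) *\<^sub>R x)) \<partial>?M)
        = (\<integral>\<^sup>+x. ennreal (1 / D w) * (ennreal (norm x) * indicator (cball 0 1) x) \<partial>?M)"
        using D[of w] by (intro nn_integral_cong)
          (auto simp: indicator_def divide_le_cancel not_le simp flip: ennreal_mult)
      also have "\<dots> = ennreal (1 / D w) * C"
        unfolding C_def by (intro nn_integral_cmult) measurable
      also have "ennreal ((1 / D w) ^ card B) * (ennreal (1 / D w) * C) = ennreal ((1 / D w) ^ DIM('a)) * C"
        unfolding card using D[of w] 
        by (subst mult.assoc[symmetric], subst ennreal_mult[symmetric]) (simp_all add: power_Suc2 del: power_Suc)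
      finally show "(\<integral>\<^sup>+x. ennreal (norm x) * indicator {..1 / D w} (norm x) \<partial>?M) = ennreal ((1 / D w) ^ DIM('a)) * C" .
    qed
    also have "\<dots> = C * (\<integral>\<^sup>+w. ennreal ((1 / D w) ^ DIM('a)) \<partial>lborel)"
      by (subst nn_integral_multc) (auto simp: mult.commute)
    finally show ?thesis by (simp add: D_def)
  qed
  have "C \<le> (\<integral>\<^sup>+x. indicator (cball 0 1) x \<partial>?M)"
    unfolding C_def by (intro nn_integral_mono) (auto simp: indicator_def ennreal_le_1)
  then have fin: "C < \<infinity>" using emeasure_cball_finite[of 1] by (simp add: order.strict_trans1)
  \<comment> \<open>\<open>C\<close> is nonzero because the constant profile 1 gives the Euclidean
    ball, which has positive volume.\<close>
  have "0 < emeasure lborel (ball (0::'a) 1)" by (simp add: emeasure_ball unit_ball_vol_pos)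
  also have "\<dots> \<le> emeasure lborel {x :: 'a. axial_gauge e (\<lambda>_. 1) x \<le> 1}"
    by (intro emeasure_mono) (auto simp: axial_gauge_def)
  finally have "C \<noteq> 0" using main[of "\<lambda>_. 1"] by auto
  then obtain c where "C = ennreal c" "c > 0" 
    using fin by (cases C) (auto simp: ennreal_eq_0_iff not_le)
  then show thesis using main that by blast
qed

section \<open>The counterexample\<close>

text \<open>
  The cylinder is not an intersection body: since \<open>quartic\<close> has integral 0 along a half circle through
  the poles, and is positive where the cylinder is bounded by its bases, cutting down the radial
  function there makes the integral negative.
\<close>

lemma integral_quartic_cyl_neg:
  assumes m: "m \<ge> 4"
  shows "(LBINT w. quartic (real m) (cosine w) / cyl (cosine w) * sine w ^ Suc m) < 0"
proof -
  let ?G = "\<lambda>w. quartic (real m) (cosine w) * sine w ^ m"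
  let ?R = "\<lambda>w. quartic (real m) (cosine w) / cyl (cosine w) * sine w ^ Suc m"
  \<comment> \<open>In the slope coordinate the cylinder amounts to a division by
    \<open>max 1 (\<bar>w\<bar> / 3)\<close>. The bases are the range
    \<open>\<bar>w\<bar> > 3\<close>, where the quartic is positive, so the division only lowers the
    integrand.\<close>
  have R: "?R w = ?G w / max 1 (\<bar>w\<bar> / 3)" for w
    using sine_pos[of w] by (simp add: cyl_cosine field_simps)
  have intR: "integrable lborel ?R"
  proof (rule Bochner_Integration.integrable_bound)
    show "integrable lborel ?G" using m by (intro integral_quartic_0) auto
    show "AE w in lborel. norm (?R w) \<le> norm (?G w)"
    proof (intro AE_I2)
      fix w :: real
      have "\<bar>?G w\<bar> / max 1 (\<bar>w\<bar> / 3) \<le> \<bar>?G w\<bar> / 1" by (intro divide_left_mono) auto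
      then show "norm (?R w) \<le> norm (?G w)" unfolding R real_norm_def abs_divide by simp
    qed
  qed measurable
  have pos: "?G w > 0" if "w \<in> {3<..}" for w
  proof -
    have "(3::real)\<^sup>2 \<le> w\<^sup>2" using that by (intro power_mono) auto
    then have "(cosine w)\<^sup>2 \<ge> 9 / 10"
      unfolding cosine_def power_mult_distrib sine_power2 by (simp add: field_simps add_pos_nonneg)
    moreover have "w\<^sup>2 > 0" using that by simp
    ultimately show ?thesis using m sine_pos[of w] by (intro mult_pos_pos quartic_pos) auto
  qed
  have pos': "?G w > 0" if "\<bar>w\<bar> > 3" for w
  proof -
    have "?G w = ?G \<bar>w\<bar>" by (simp add: quartic_def cosine_def sine_def power_mult_distrib abs_if)
    then show ?thesis using pos[of "\<bar>w\<bar>"] that by simp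
  qed
  have le: "?R w \<le> ?G w" for w
    unfolding R using pos'[of w] by (cases "\<bar>w\<bar> > 3") (auto simp: divide_le_eq intro!: mult_left_mono)
  have intG: "integrable lborel ?G" using m by (intro integral_quartic_0) auto
  \<comment> \<open>Strictness: a zero difference would force equality almost everywhere, but the
    integrands differ on the whole interval from 3 to 4.\<close>
  have "(LBINT w. ?G w - ?R w) \<noteq> 0"
  proof
    assume "(LBINT w. ?G w - ?R w) = 0"
    then have "AE w in lborel. ?G w - ?R w = 0"
      using intG intR le by (subst (asm) integral_nonneg_eq_0_iff_AE) auto
    then have "AE w in lborel. w \<notin> {3<..<4::real}"
    proof eventually_elim
      fix w assume "?G w - ?R w = 0"
      then show "w \<notin> {3<..<4}" unfolding R using pos[of w] sine_pos[of w] by (auto simp: field_simps)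
    qed
    then have "emeasure lborel {3<..<4::real} = 0"
      by (subst (asm) AE_iff_measurable[of "{3<..<4}"]) auto
    then show False by simp
  qed
  moreover have "0 \<le> (LBINT w. ?G w - ?R w)"
    using le by (intro Bochner_Integration.integral_nonneg) auto
  ultimately have "(LBINT w. ?R w) < (LBINT w. ?G w)"
    using intG intR by simp
  also have "\<dots> = 0" using m by (intro integral_quartic_0) auto
  finally show ?thesis .
qed

text \<open>The sign survives small changes: \<open>d\<close> will make the gauge strictly curved,
  and \<open>3 * \<delta>\<close> leaves room for the errors of a polynomial approximation. Both
  parameters receive the same value.\<close>

lemma perturbation_parameters:
  assumes m: "m \<ge> 4"
  obtains d \<delta> :: real where "d > 0" "\<delta> > 0"
    "(LBINT w. (quartic (real m) (cosine w) + 3 * \<delta>) / (cyl (cosine w) + d) * sine w ^ Suc m) < 0"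
proof -
  let ?F = "\<lambda>w. quartic (real m) (cosine w)" and ?p = "\<lambda>w. cyl (cosine w)"
  have p: "?p w \<ge> 3 / 10" for w by (rule cyl_ge[OF abs_cosine_le_1])
  define M where "M = 1 + 2 * real m + real m * (real m + 2) / 3"
  have M: "\<bar>?F w\<bar> \<le> M" for w unfolding M_def by (rule quartic_bound) (auto simp: abs_cosine_le_1)
  have M1: "M \<ge> 1" by (simp add: M_def)
  define J where "J = (LBINT w. ?F w / ?p w * sine w ^ Suc m)"
  have J: "J < 0" unfolding J_def by (rule integral_quartic_cyl_neg[OF m])
  define W where "W = (LBINT w. 1 * sine w ^ Suc m)"
  have W: "W \<ge> 0" unfolding W_def using sine_pos by (intro Bochner_Integration.integral_nonneg) (auto intro: less_imp_le)
  have int1: "integrable lborel (\<lambda>w. 1 * sine w ^ Suc m)"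
    using m by (intro integrable_bounded_weight[of _ _ 1]) auto
  have Fp: "\<bar>?F w / ?p w\<bar> \<le> M / (3 / 10)" for w
    unfolding abs_divide using p[of w] M[of w] M1 by (intro frac_le) auto
  have intJ: "integrable lborel (\<lambda>w. ?F w / ?p w * sine w ^ Suc m)"
    using m by (intro integrable_bounded_weight[OF _ _ Fp]) auto
  \<comment> \<open>As \<open>?p w \<ge> 3 / 10\<close>, the numerator changes the quotient by at
    most \<open>10 * d\<close> and the denominator by at most \<open>100 / 9 * M * d\<close>. The
    choice of \<open>d\<close> makes the total at most \<open>- J / 2\<close>; the added 1 keeps its
    denominator positive.\<close>
  define K where "K = 12 * M + 10"
  have K: "K > 0" using M1 by (simp add: K_def)
  define d where "d = - J / (2 * (K * W + 1))"
  have KW: "K * W + 1 > 0" using K W by (simp add: add_nonneg_pos)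
  have d: "d > 0" unfolding d_def using J KW by (intro divide_pos_pos mult_pos_pos) auto
  have le: "(?F w + 3 * d) / (?p w + d) * sine w ^ Suc m \<le> ?F w / ?p w * sine w ^ Suc m + K * d * (1 * sine w ^ Suc m)" for w
  proof -
    have "(?F w + 3 * d) / (?p w + d) - ?F w / ?p w = 3 * d / (?p w + d) - ?F w * d / (?p w * (?p w + d))"
    proof -
      have "F * (b - a) / (a * b) = F / a - F / b" if "a \<noteq> 0" "b \<noteq> 0" for F a b :: real
        using that by (simp add: field_simps)
      from this[of "?p w" "?p w + d" "?F w"] show ?thesis
        using p[of w] d by (simp add: add_divide_distrib)
    qed
    also have "\<dots> \<le> 3 * d / (3 / 10) + M * d / (3 / 10 * (3 / 10))"
    proof -
      have "3 * d / (?p w + d) \<le> 3 * d / (3 / 10)" using p[of w] d by (intro divide_left_mono) auto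
      moreover have "\<bar>?F w * d / (?p w * (?p w + d))\<bar> \<le> M * d / (3 / 10 * (3 / 10))"
        unfolding abs_divide abs_mult using p[of w] d M[of w] M1 by (intro frac_le mult_mono) auto
      ultimately show ?thesis by linarith
    qed
    also have "\<dots> \<le> K * d" using d M1 by (simp add: K_def algebra_simps)
    finally have "(?F w + 3 * d) / (?p w + d) \<le> ?F w / ?p w + K * d" by simp
    then have "(?F w + 3 * d) / (?p w + d) * sine w ^ Suc m \<le> (?F w / ?p w + K * d) * sine w ^ Suc m"
      using sine_pos[of w] by (intro mult_right_mono) auto
    then show ?thesis by (simp add: distrib_right)
  qed
  have "(LBINT w. (?F w + 3 * d) / (?p w + d) * sine w ^ Suc m)
    \<le> (LBINT w. ?F w / ?p w * sine w ^ Suc m + K * d * (1 * sine w ^ Suc m))"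
  proof (rule integral_mono)
    have b: "\<bar>(?F w + 3 * d) / (?p w + d)\<bar> \<le> (M + 3 * d) / (3 / 10)" for w
      unfolding abs_divide using p[of w] M[of w] M1 d by (intro frac_le) auto
    then show "integrable lborel (\<lambda>w. (?F w + 3 * d) / (?p w + d) * sine w ^ Suc m)"
      using m by (intro integrable_bounded_weight[OF _ _ b]) auto
    show "integrable lborel (\<lambda>w. ?F w / ?p w * sine w ^ Suc m + K * d * (1 * sine w ^ Suc m))"
      using intJ int1 by simp
  qed (rule le)
  also have "\<dots> = J + K * d * W"
    unfolding J_def W_def using intJ int1 by (subst Bochner_Integration.integral_add) auto
  also have "\<dots> < 0"
  proof -
    have "K * W * d \<le> (K * W + 1) * d" using d by simp
    also have "\<dots> = - J / 2" 
    proof -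
      have "x * (- J / (2 * x)) = - J / 2" if "x \<noteq> 0" for x using that by simp
      from this[of "K * W + 1"] show ?thesis unfolding d_def using KW by simp
    qed
    finally show ?thesis using J by (simp add: mult_ac)
  qed
  finally show thesis using d that by blast
qed

text \<open>Stone-Weierstrass, followed by averaging over \<open>u\<close> and \<open>- u\<close>.
  Evenness keeps the perturbed body symmetric.\<close>

lemma even_polynomial_approximation:
  fixes g :: "real \<Rightarrow> real"
  assumes "continuous_on {-1..1} g" "\<And>u. g (- u) = g u" "\<epsilon> > 0"
  obtains h where "real_polynomial_function h" "\<And>u. h (- u) = h u"
    "\<And>u. \<bar>u\<bar> \<le> 1 \<Longrightarrow> \<bar>g u - h u\<bar> < \<epsilon>"
proof -
  obtain h where h: "real_polynomial_function h" "\<And>u. u \<in> {-1..1} \<Longrightarrow> \<bar>g u - h u\<bar> < \<epsilon>"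
    using Stone_Weierstrass_real_polynomial_function[OF compact_Icc assms(1,3)] by blast
  have "polynomial_function (\<lambda>u::real. - u)"
    by (intro polynomial_function_bounded_linear bounded_linear_minus bounded_linear_ident)
  from real_polynomial_function_compose[OF this h(1)]
  have "real_polynomial_function (\<lambda>u. h (- u))" by (simp add: o_def)
  then have "real_polynomial_function (\<lambda>u. (h u + h (- u)) * (1 / 2))"
    by (intro real_polynomial_function.intros(2-4) h(1))
  moreover have "\<bar>g u - (h u + h (- u)) * (1 / 2)\<bar> < \<epsilon>" if "\<bar>u\<bar> \<le> 1" for u
  proof -
    have "\<bar>g u - h u\<bar> < \<epsilon>" "\<bar>g u - h (- u)\<bar> < \<epsilon>"
      using h(2)[of u] h(2)[of "- u"] that assms(2)[of u] by (auto simp: abs_le_iff)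
    moreover have "g u - (h u + h (- u)) * (1 / 2) = ((g u - h u) + (g u - h (- u))) / 2" by (simp add: field_simps)
    ultimately show ?thesis unfolding abs_less_iff by (simp add: field_simps)
  qed
  ultimately show thesis using that[of "\<lambda>u. (h u + h (- u)) * (1 / 2)"] by (simp add: add.commute)
qed

text \<open>The right-hand side is a maximum of two seminorms, which gives the triangle inequality
  although the profile has a kink at the rim.\<close>

lemma axial_gauge_cyl:
  assumes e: "norm e = 1"
  shows "axial_gauge e cyl x = max (norm (x - (e \<bullet> x) *\<^sub>R e)) (\<bar>e \<bullet> x\<bar> / 3)"
proof (cases "x = 0")
  case False
  have "(norm (x - (e \<bullet> x) *\<^sub>R e))\<^sup>2 = (norm x)\<^sup>2 - (e \<bullet> x)\<^sup>2"
    using e unfolding power2_norm_eq_inner norm_eq_1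
    by (simp add: inner_diff_left inner_diff_right inner_commute power2_eq_square)
  also have "\<dots> = (norm x)\<^sup>2 * (1 - (e \<bullet> x / norm x)\<^sup>2)"
    using False by (simp add: power_divide right_diff_distrib)
  finally have "norm (x - (e \<bullet> x) *\<^sub>R e) = sqrt ((norm x)\<^sup>2 * (1 - (e \<bullet> x / norm x)\<^sup>2))"
    by (metis norm_ge_zero real_sqrt_unique)
  also have "\<dots> = norm x * sqrt (1 - (e \<bullet> x / norm x)\<^sup>2)" by (simp add: real_sqrt_mult)
  finally show ?thesis using False
    by (simp add: axial_gauge_def cyl_def max_mult_distrib_left)
qed simp

lemma axial_gauge_cyl_triangle:
  assumes e: "norm e = 1"
  shows "axial_gauge e cyl (x + y) \<le> axial_gauge e cyl x + axial_gauge e cyl y"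
proof -
  have "x + y - (e \<bullet> (x + y)) *\<^sub>R e = (x - (e \<bullet> x) *\<^sub>R e) + (y - (e \<bullet> y) *\<^sub>R e)"
    by (simp add: inner_add_right algebra_simps)
  then have "norm (x + y - (e \<bullet> (x + y)) *\<^sub>R e) \<le> norm (x - (e \<bullet> x) *\<^sub>R e) + norm (y - (e \<bullet> y) *\<^sub>R e)"
    using norm_triangle_ineq by metis
  moreover have "\<bar>e \<bullet> (x + y)\<bar> / 3 \<le> \<bar>e \<bullet> x\<bar> / 3 + \<bar>e \<bullet> y\<bar> / 3"
    using abs_triangle_ineq[of "e \<bullet> x" "e \<bullet> y"] by (simp add: inner_add_right)
  ultimately show ?thesis unfolding axial_gauge_cyl[OF e] by linarith
qed

text \<open>
  Only the summand \<open>d\<close> is perturbed: it contributes \<open>d * norm x\<close>, whose curvature dominates that of a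
  small multiple of \<open>h\<close>, while the part of the cylinder stays untouched and need not be smooth.
\<close>

lemma perturbed_gauge_triangle:
  fixes e :: "'a::real_inner"
  assumes e: "norm e = 1"
    and h: "\<And>v. \<bar>v\<bar> \<le> 1 \<Longrightarrow> \<bar>h v\<bar> \<le> C" "\<And>v. \<bar>v\<bar> \<le> 1 \<Longrightarrow> \<bar>h' v\<bar> \<le> C"
      "\<And>u v. \<bar>u\<bar> \<le> 1 \<Longrightarrow> \<bar>v\<bar> \<le> 1 \<Longrightarrow> \<bar>h u - h v - h' v * (u - v)\<bar> \<le> C * (u - v)\<^sup>2"
    and \<eta>: "0 \<le> \<eta>" "4 * \<eta> * C \<le> d"
  shows "axial_gauge e (\<lambda>u. cyl u + (d + \<eta> * h u)) (x + y)
    \<le> axial_gauge e (\<lambda>u. cyl u + (d + \<eta> * h u)) x + axial_gauge e (\<lambda>u. cyl u + (d + \<eta> * h u)) y"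
proof -
  have C: "0 \<le> C" using h(1)[of 0] by simp
  \<comment> \<open>The two perturbation terms cost at most \<open>\<eta> * C\<close> each, leaving
    half of \<open>4 * \<eta> * C\<close>. Multiplied by \<open>(u - v)\<^sup>2 / 2\<close>, this is
    just enough for the Taylor remainder \<open>\<eta> * C * (u - v)\<^sup>2\<close>.\<close>
  have A: "2 * \<eta> * C \<le> (d + \<eta> * h v) - v * (\<eta> * h' v)" if v: "\<bar>v\<bar> \<le> 1" for v
  proof -
    have "\<bar>\<eta> * h v\<bar> \<le> \<eta> * C" using h(1)[OF v] \<eta> by (simp add: abs_mult mult_left_mono)
    moreover have "\<bar>v * (\<eta> * h' v)\<bar> \<le> 1 * (\<eta> * C)"
      unfolding abs_mult using h(2)[OF v] v \<eta> C by (intro mult_mono) auto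
    ultimately show ?thesis using \<eta>(2) by linarith
  qed
  have "axial_gauge e (\<lambda>u. d + \<eta> * h u) (x + y) 
    \<le> axial_gauge e (\<lambda>u. d + \<eta> * h u) x + axial_gauge e (\<lambda>u. d + \<eta> * h u) y"
  proof (rule axial_gauge_triangle[OF e, where p' = "\<lambda>v. \<eta> * h' v"])
    fix v :: real assume v: "\<bar>v\<bar> \<le> 1"
    have "0 \<le> 2 * \<eta> * C" using \<eta> C by simp
    then show "0 \<le> (d + \<eta> * h v) - v * (\<eta> * h' v)" using A[OF v] by linarith
    fix u :: real assume u: "\<bar>u\<bar> \<le> 1"
    have "2 * \<eta> * C * ((u - v)\<^sup>2 / 2) \<le> ((d + \<eta> * h v) - v * (\<eta> * h' v)) * ((u - v)\<^sup>2 / 2)"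
      using A[OF v] by (intro mult_right_mono) auto
    moreover have "\<eta> * (- (C * (u - v)\<^sup>2)) \<le> \<eta> * (h u - h v - h' v * (u - v))"
      using h(3)[OF u v] \<eta> by (intro mult_left_mono) auto
    moreover have "\<eta> * (h u - h v - h' v * (u - v)) = \<eta> * h u - \<eta> * h v - \<eta> * h' v * (u - v)"
      by (simp add: algebra_simps)
    moreover have "\<eta> * (- (C * (u - v)\<^sup>2)) = - (2 * \<eta> * C * ((u - v)\<^sup>2 / 2))" by simp
    ultimately show "(d + \<eta> * h v) + \<eta> * h' v * (u - v) - ((d + \<eta> * h v) - v * (\<eta> * h' v)) * (u - v)\<^sup>2 / 2 \<le> d + \<eta> * h u"
      by (simp only: times_divide_eq_right)
  qed
  then show ?thesis
    using axial_gauge_cyl_triangle[OF e, of x y]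
    by (simp add: axial_gauge_add[of e cyl "\<lambda>u. d + \<eta> * h u"])
qed

text \<open>Bernoulli's inequality for the denominator, then a second-order bound for
  \<open>1 / (1 + y)\<close>. With \<open>x\<close> the relative change of the gauge, this bounds
  the sections of the perturbed body from above; the quadratic term is later absorbed by
  \<open>\<delta>\<close>.\<close>

lemma inverse_power_upper:
  fixes x :: real
  assumes "\<bar>real m * x\<bar> \<le> 1 / 2" "\<bar>x\<bar> \<le> 1 / 2"
  shows "(1 / (1 + x)) ^ m \<le> 1 - real m * x + 2 * (real m * x)\<^sup>2"
proof -
  define y where "y = real m * x"
  have y: "\<bar>y\<bar> \<le> 1 / 2" using assms by (simp add: y_def)
  have "1 + y \<le> (1 + x) ^ m" unfolding y_def using assms(2) by (intro Bernoulli_inequality) auto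
  then have "(1 / (1 + x)) ^ m \<le> 1 / (1 + y)"
    using y by (simp add: power_divide frac_le)
  also have "\<dots> \<le> 1 - y + 2 * y\<^sup>2"
  proof -
    have "0 \<le> y\<^sup>2 * (1 + 2 * y)" using y by (intro mult_nonneg_nonneg) auto
    then have "1 \<le> (1 - y + 2 * y\<^sup>2) * (1 + y)" by (simp add: power2_eq_square algebra_simps)
    then show ?thesis using y by (auto simp: pos_divide_le_eq)
  qed
  finally show ?thesis by (simp add: y_def)
qed

text \<open>For the volume a lower bound is wanted, and the tangent of a convex function provides it
  without an error term.\<close>

lemma inverse_power_lower:
  fixes x :: real
  assumes "\<bar>x\<bar> \<le> 1 / 2"
  shows "1 - real n * x \<le> (1 / (1 + x)) ^ n"
proof -
  have "1 + real n * (- x) \<le> (1 + - x) ^ n" using assms by (intro Bernoulli_inequality) auto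
  also have "\<dots> \<le> (1 / (1 + x)) ^ n"
  proof (intro power_mono)
    have "(1 - x) * (1 + x) \<le> 1" by (simp add: algebra_simps)
    then show "1 + - x \<le> 1 / (1 + x)" using assms by (simp add: pos_le_divide_eq)
  qed (use assms in auto)
  finally show ?thesis by simp
qed

lemma cyl_continuous: "continuous_on UNIV cyl"
  unfolding cyl_def by (intro continuous_intros) auto

lemma body_gauge_axial:
  fixes e :: "'a::euclidean_space"
  assumes "norm e = 1" "\<And>u. p (- u) = p u" "c > 0" "\<And>u. \<bar>u\<bar> \<le> 1 \<Longrightarrow> c \<le> p u"
    and "\<And>x y. axial_gauge e p (x + y) \<le> axial_gauge e p x + axial_gauge e p y"
  shows "body_gauge (axial_gauge e p) c"
  using assms by unfold_locales (auto simp: axial_gauge_scaleR axial_gauge_minus intro: axial_gauge_bounds)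

text \<open>\<open>M\<close> and \<open>N\<close> are the gauges of \<open>K\<close> and
  \<open>L\<close>. Sections are compared for every orthonormal set of the right size, so that the
  result covers whichever basis \<open>subspace_lborel\<close> selects.\<close>

lemma Busemann_Petty_counterexample:
  fixes e :: "'a::euclidean_space"
  assumes e: "e \<in> Basis" and dim: "DIM('a) \<ge> 5"
  obtains M N :: "'a \<Rightarrow> real" and b c where "body_gauge M b" "body_gauge N c"
    "\<And>B. orthonormal_set B \<Longrightarrow> Suc (card B) = DIM('a) \<Longrightarrow>
       emeasure (span_lborel B) {x. M x \<le> 1} \<le> emeasure (span_lborel B) {x. N x \<le> 1}"
    "emeasure lborel {x. N x \<le> 1} < emeasure lborel {x. M x \<le> 1}"
proof -
  have ne: "norm e = 1" using e by simp
  define m where "m = DIM('a) - 1"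
  have m: "m \<ge> 4" and Suc_m: "Suc m = DIM('a)" using dim by (auto simp: m_def)
  obtain d \<delta> where d: "d > 0" and \<delta>: "\<delta> > 0" and
    neg: "(LBINT w. (quartic (real m) (cosine w) + 3 * \<delta>) / (cyl (cosine w) + d) * sine w ^ Suc m) < 0"
    by (rule perturbation_parameters[OF m])
  define q where "q u = cyl u + d" for u
  have q: "q u \<ge> 3 / 10" if "\<bar>u\<bar> \<le> 1" for u using cyl_ge[OF that] d by (simp add: q_def)
  have q_cont: "continuous_on UNIV q" unfolding q_def by (intro continuous_intros cyl_continuous)
  have q_even: "q (- u) = q u" for u by (simp add: q_def cyl_def)
  have quartic_cont: "continuous_on A (quartic (real m))" for A
    unfolding quartic_def by (intro continuous_intros)
  \<comment> \<open>To first order, passing from \<open>q\<close> to \<open>q + \<eta> * h\<close>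
    changes \<open>(1 / q u) ^ m\<close> by \<open>- \<eta> * m * h u / q u ^ Suc m\<close>.
    Equating this with \<open>- \<eta> * (quartic (real m) u + 2 * \<delta>)\<close> and solving for
    \<open>h\<close> gives \<open>g\<close>.\<close>
  define g where "g u = q u ^ Suc m * (quartic (real m) u + 2 * \<delta>) / m" for u
  \<comment> \<open>As \<open>q u \<ge> 3 / 10\<close>, this tolerance moves the first-order term
    \<open>F\<close> below by at most \<open>\<delta>\<close>, which keeps it between
    \<open>\<delta>\<close> and \<open>3 * \<delta>\<close> above the quartic.\<close>
  define \<epsilon> where "\<epsilon> = \<delta> * (3 / 10) ^ Suc m / m"
  have \<epsilon>: "\<epsilon> > 0" using \<delta> m by (simp add: \<epsilon>_def)
  obtain h where h: "real_polynomial_function h" and h_even: "\<And>u. h (- u) = h u"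
    and approx: "\<And>u. \<bar>u\<bar> \<le> 1 \<Longrightarrow> \<bar>g u - h u\<bar> < \<epsilon>"
  proof (rule even_polynomial_approximation[OF _ _ \<epsilon>])
    show "continuous_on {-1..1} g" unfolding g_def using m
      by (intro continuous_intros quartic_cont continuous_on_subset[OF q_cont]) auto
    show "g (- u) = g u" for u by (simp add: g_def q_even quartic_def)
  qed blast
  define F where "F u = m * h u / q u ^ Suc m" for u
  have F: "quartic (real m) u + \<delta> \<le> F u" "F u \<le> quartic (real m) u + 3 * \<delta>" if u: "\<bar>u\<bar> \<le> 1" for u
  proof -
    have qm: "(3 / 10) ^ Suc m \<le> q u ^ Suc m" using q[OF u] by (intro power_mono) auto
    have qp: "0 < q u ^ Suc m" using q[OF u] by simp
    have "F u - (quartic (real m) u + 2 * \<delta>) = m * (h u - g u) / q u ^ Suc m"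
    proof -
      have "real m * (x - y * z / real m) / y = real m * x / y - z" if "y > 0" for x y z
        using that m by (simp add: field_simps)
      from this[OF qp] show ?thesis by (simp add: F_def g_def del: power_Suc)
    qed
    moreover have "\<bar>m * (h u - g u) / q u ^ Suc m\<bar> \<le> \<delta>"
    proof -
      have "\<bar>m * (h u - g u)\<bar> \<le> m * \<epsilon>" using approx[OF u] by (simp add: abs_mult abs_minus_commute mult_left_mono)
      also have "\<dots> = \<delta> * (3 / 10) ^ Suc m" using m by (simp add: \<epsilon>_def del: power_Suc)
      also have "\<dots> \<le> \<delta> * q u ^ Suc m" using qm \<delta> by (intro mult_left_mono) auto
      finally show ?thesis using qp by (simp add: abs_divide pos_divide_le_eq del: power_Suc)
    qed
    ultimately have "\<bar>F u - (quartic (real m) u + 2 * \<delta>)\<bar> \<le> \<delta>" by simp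
    then show "quartic (real m) u + \<delta> \<le> F u" "F u \<le> quartic (real m) u + 3 * \<delta>" by linarith+
  qed
  obtain C h' where C: "\<And>v. \<bar>v\<bar> \<le> 1 \<Longrightarrow> \<bar>h v\<bar> \<le> C" "\<And>v. \<bar>v\<bar> \<le> 1 \<Longrightarrow> \<bar>h' v\<bar> \<le> C"
      "\<And>u v. \<bar>u\<bar> \<le> 1 \<Longrightarrow> \<bar>v\<bar> \<le> 1 \<Longrightarrow> \<bar>h u - h v - h' v * (u - v)\<bar> \<le> C * (u - v)\<^sup>2"
    using quadratic_taylor_polynomial[OF h] unfolding quadratic_taylor_def by blast
  have C0: "C \<ge> 0" using C(1)[of 0] by simp
  define C' where "C' = C + 1"
  have C': "C' > 0" using C0 by (simp add: C'_def)
  \<comment> \<open>The three bounds serve the convexity of the perturbed gauge, the smallness of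
    the relative change \<open>X\<close>, and the domination of the second-order error by
    \<open>\<delta>\<close>. \<open>C'\<close> stands in for \<open>C\<close> to make the
    denominators positive.\<close>
  define \<eta> where "\<eta> = min (d / (4 * C')) (min (3 / (20 * m * C')) (\<delta> * (3 / 10) ^ (m + 2) / (2 * (m * C')\<^sup>2)))"
  have \<eta>: "\<eta> > 0" using d C' \<delta> m by (simp add: \<eta>_def)
  have "\<eta> \<le> d / (4 * C')" by (simp add: \<eta>_def)
  then have \<eta>1': "4 * \<eta> * C' \<le> d" using C' by (simp add: field_simps)
  have "\<eta> \<le> 3 / (20 * m * C')" by (simp add: \<eta>_def)
  then have \<eta>2: "m * (\<eta> * C') \<le> 3 / 20" using C' m by (simp add: field_simps)
  have "\<eta> \<le> \<delta> * (3 / 10) ^ (m + 2) / (2 * (m * C')\<^sup>2)" by (simp add: \<eta>_def)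
  then have \<eta>3: "2 * \<eta> * (m * C')\<^sup>2 \<le> \<delta> * (3 / 10) ^ (m + 2)"
    using C' m by (simp add: pos_le_divide_eq mult_ac)
  have \<eta>1: "4 * \<eta> * C \<le> d"
    using \<eta> \<eta>1' by (simp add: C'_def algebra_simps)
  define p where "p u = q u + \<eta> * h u" for u
  define X where "X u = \<eta> * h u / q u" for u
  have hC: "\<bar>\<eta> * h u\<bar> \<le> \<eta> * C'" if "\<bar>u\<bar> \<le> 1" for u
    using C(1)[OF that] \<eta> by (simp add: abs_mult C'_def)
  have X: "\<bar>real m * X u\<bar> \<le> 1 / 2" "\<bar>X u\<bar> \<le> 1 / 2" if u: "\<bar>u\<bar> \<le> 1" for u
  proof -
    have "\<bar>real m * X u\<bar> = m * \<bar>\<eta> * h u\<bar> / q u" using q[OF u] by (simp add: X_def abs_mult)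
    also have "\<dots> \<le> m * (\<eta> * C') / (3 / 10)" using hC[OF u] q[OF u] by (intro frac_le mult_left_mono) auto
    also have "\<dots> \<le> 1 / 2" using \<eta>2 by simp
    finally show *: "\<bar>real m * X u\<bar> \<le> 1 / 2" .
    have "\<bar>X u\<bar> \<le> m * \<bar>X u\<bar>" using m by (simp add: mult_le_cancel_right1)
    then show "\<bar>X u\<bar> \<le> 1 / 2" using * by (simp add: abs_mult)
  qed
  have pX: "p u = q u * (1 + X u)" if "\<bar>u\<bar> \<le> 1" for u
    using q[OF that] by (simp add: p_def X_def field_simps)
  have p: "p u \<ge> 3 / 20" if u: "\<bar>u\<bar> \<le> 1" for u
  proof -
    have "(3 / 10) * (1 / 2) \<le> q u * (1 + X u)" using q[OF u] X(2)[OF u] by (intro mult_mono) auto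
    then show ?thesis by (simp add: pX[OF u])
  qed
  have h_cont: "continuous_on UNIV h"
    using h by (intro continuous_on_polymonial_function) (auto simp: real_polynomial_function_eq)
  have p_cont: "continuous_on UNIV p" unfolding p_def by (intro continuous_intros q_cont h_cont)
  have p_even: "p (- u) = p u" for u by (simp add: p_def q_even h_even)
  have p_gauge: "body_gauge (axial_gauge e p) (3 / 20)"
  proof (rule body_gauge_axial[where p = p, OF ne p_even _ p])
    fix x y
    have "p = (\<lambda>u. cyl u + (d + \<eta> * h u))" by (auto simp: p_def q_def)
    then show "axial_gauge e p (x + y) \<le> axial_gauge e p x + axial_gauge e p y"
      using perturbed_gauge_triangle[where h = h and h' = h' and C = C and \<eta> = \<eta> and d = d, OF ne C] \<eta> \<eta>1 by simp
  qed simp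
  have q_gauge: "body_gauge (axial_gauge e q) (3 / 10)"
  proof (rule body_gauge_axial[where p = q, OF ne q_even _ q])
    fix x y
    have "q = (\<lambda>u. cyl u + (d + 0 * h u))" by (auto simp: q_def)
    then show "axial_gauge e q (x + y) \<le> axial_gauge e q x + axial_gauge e q y"
      using perturbed_gauge_triangle[where h = h and h' = h' and C = C and \<eta> = 0 and d = d, OF ne C] d by simp
  qed simp
  have sections: "emeasure (span_lborel B) {x. axial_gauge e p x \<le> 1} \<le> emeasure (span_lborel B) {x. axial_gauge e q x \<le> 1}"
    if B: "orthonormal_set B" "Suc (card B) = DIM('a)" for B :: "'a set"
  proof -
    interpret orthonormal_set B by fact
    have card: "card B = m" using B(2) Suc_m by simp
    show ?thesis
    proof (rule emeasure_gauge_mono)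
      show "B \<noteq> {}" using card m by auto
      show "p u > 0" "q u > 0" if "\<bar>u\<bar> \<le> 1" for u using p[OF that] q[OF that] by auto
      fix u :: real assume u: "\<bar>u\<bar> \<le> 1"
      have q0: "q u > 0" using q[OF u] by simp
      have "(1 / p u) ^ m = (1 / q u) ^ m * (1 / (1 + X u)) ^ m"
        by (simp add: pX[OF u] power_divide power_mult_distrib)
      also have "\<dots> \<le> (1 / q u) ^ m * (1 - real m * X u + 2 * (real m * X u)\<^sup>2)"
        using q0 by (intro mult_left_mono inverse_power_upper X u) auto
      also have "\<dots> = (1 / q u) ^ m - \<eta> * F u + \<eta> * (2 * \<eta> * (m * h u)\<^sup>2 / q u ^ (m + 2))"
        using q0 by (simp add: X_def F_def power_divide power_add field_simps power2_eq_square)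
      also have "2 * \<eta> * (m * h u)\<^sup>2 / q u ^ (m + 2) \<le> \<delta>"
      proof -
        have "(m * h u)\<^sup>2 \<le> (m * C')\<^sup>2"
          using C(1)[OF u] C' by (intro power2_le_iff_abs_le[THEN iffD2]) (auto simp: abs_mult C'_def mult_left_mono)
        then have "2 * \<eta> * (m * h u)\<^sup>2 \<le> 2 * \<eta> * (m * C')\<^sup>2" using \<eta> by (intro mult_left_mono) auto
        also note \<eta>3
        also have "\<delta> * (3 / 10) ^ (m + 2) \<le> \<delta> * q u ^ (m + 2)"
          using q[OF u] \<delta> by (intro mult_left_mono power_mono) auto
        finally show ?thesis using q0 by (simp add: pos_divide_le_eq del: power_Suc)
      qed
      \<comment> \<open>The second-order error \<open>\<eta> * \<delta>\<close> is paid for by the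
        margin \<open>\<delta>\<close> of \<open>F\<close> over the quartic.\<close>
      finally have "(1 / p u) ^ m \<le> (1 / q u) ^ m - \<eta> * F u + \<eta> * \<delta>"
        using \<eta> by (simp add: mult_left_mono)
      moreover have "\<eta> * (quartic (real m) u + \<delta>) \<le> \<eta> * F u" using F(1)[OF u] \<eta> by (intro mult_left_mono) auto
      ultimately show "(1 / p u) ^ card B + \<eta> * (1 + real (card B) * (real (card B) + 2) / 3 * u ^ 4)
        \<le> (1 / q u) ^ card B + \<eta> * (2 * real (card B) * u\<^sup>2)"
        unfolding card quartic_def by (simp add: algebra_simps)
    qed (use p_cont q_cont ne \<eta> in auto)
  qed
  have volume: "emeasure lborel {x. axial_gauge e q x \<le> 1} < emeasure lborel {x. axial_gauge e p x \<le> 1}"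
  proof -
    obtain K where K: "K > 0" and vol: "\<And>p. continuous_on UNIV p \<Longrightarrow> (\<And>u. \<bar>u\<bar> \<le> 1 \<Longrightarrow> p u > 0) \<Longrightarrow>
      emeasure lborel {x :: 'a. axial_gauge e p x \<le> 1}
        = ennreal K * (\<integral>\<^sup>+w. ennreal ((sine w / p (cosine w)) ^ DIM('a)) \<partial>lborel)"
      using emeasure_axial_gauge[OF e] dim by auto
    define J where "J r = (LBINT w. (1 / r (cosine w)) ^ Suc m * sine w ^ Suc m)" for r
    have int: "integrable lborel (\<lambda>w. (1 / r (cosine w)) ^ Suc m * sine w ^ Suc m)"
      if r: "continuous_on UNIV r" "\<And>u. \<bar>u\<bar> \<le> 1 \<Longrightarrow> r u \<ge> 3 / 20" for r
    proof (rule integrable_bounded_weight)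
      have [measurable]: "r \<in> borel_measurable borel" using r(1) by (rule borel_measurable_continuous_onI)
      show "(\<lambda>w. (1 / r (cosine w)) ^ Suc m) \<in> borel_measurable borel" by measurable
      fix w
      have "r (cosine w) \<ge> 3 / 20" by (rule r(2)[OF abs_cosine_le_1])
      then have "1 / r (cosine w) \<le> 1 / (3 / 20)" "0 \<le> 1 / r (cosine w)"
        using frac_le[of 1 1 "3 / 20" "r (cosine w)"] by auto
      then have "(1 / r (cosine w)) ^ Suc m \<le> (1 / (3 / 20)) ^ Suc m" "0 \<le> (1 / r (cosine w)) ^ Suc m"
        using power_mono[of "1 / r (cosine w)" "1 / (3 / 20)" "Suc m"] zero_le_power by blast+
      then show "\<bar>(1 / r (cosine w)) ^ Suc m\<bar> \<le> (1 / (3 / 20)) ^ Suc m" by linarith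
    qed (use m in auto)
    have J: "emeasure lborel {x :: 'a. axial_gauge e r x \<le> 1} = ennreal (K * J r)"
      if r: "continuous_on UNIV r" "\<And>u. \<bar>u\<bar> \<le> 1 \<Longrightarrow> r u \<ge> 3 / 20" for r
    proof -
      have pos: "r (cosine w) > 0" for w using r(2)[OF abs_cosine_le_1, of w] by simp
      have nn: "0 \<le> (1 / r (cosine w)) ^ Suc m * sine w ^ Suc m" for w
        using pos[of w] sine_pos[of w] by (intro mult_nonneg_nonneg zero_le_power) auto
      have "emeasure lborel {x :: 'a. axial_gauge e r x \<le> 1}
        = ennreal K * (\<integral>\<^sup>+w. ennreal ((1 / r (cosine w)) ^ Suc m * sine w ^ Suc m) \<partial>lborel)"
        unfolding Suc_m using r by (subst vol) (force simp: power_divide)+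
      also have "\<dots> = ennreal K * ennreal (J r)"
        unfolding J_def by (subst nn_integral_eq_integral[OF int[where r = r, OF r]]) (auto simp: nn simp del: power_Suc)
      finally show ?thesis using K by (simp add: ennreal_mult')
    qed
    define I where "I = (LBINT w. (quartic (real m) (cosine w) + 3 * \<delta>) / q (cosine w) * sine w ^ Suc m)"
    have I: "I < 0" using neg by (simp add: I_def q_def)
    \<comment> \<open>A function that is not integrable has integral 0 by convention, so the
      negative sign of \<open>I\<close> implies integrability.\<close>
    have intI: "integrable lborel (\<lambda>w. (quartic (real m) (cosine w) + 3 * \<delta>) / q (cosine w) * sine w ^ Suc m)"
      using I by (rule contrapos_pp) (simp add: I_def not_integrable_integral_eq)
    \<comment> \<open>With \<open>n = Suc m\<close>, the tangent bound lowers
      \<open>(1 / q u) ^ n\<close> by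
      \<open>n * X u / q u ^ n = \<eta> * (n / m) * F u / q u\<close>. Replacing \<open>F\<close> by
      its upper bound leads to the integral \<open>I\<close>, which is negative, so the volume
      grows.\<close>
    have pw: "(1 / q (cosine w)) ^ Suc m * sine w ^ Suc m 
        - \<eta> * (Suc m / m) * ((quartic (real m) (cosine w) + 3 * \<delta>) / q (cosine w) * sine w ^ Suc m)
      \<le> (1 / p (cosine w)) ^ Suc m * sine w ^ Suc m" for w
    proof -
      define u where "u = cosine w"
      have u: "\<bar>u\<bar> \<le> 1" unfolding u_def by (rule abs_cosine_le_1)
      have q0: "q u > 0" using q[OF u] by simp
      have "(1 / q u) ^ Suc m - \<eta> * (Suc m / m) * ((quartic (real m) u + 3 * \<delta>) / q u)
        \<le> (1 / q u) ^ Suc m - \<eta> * (Suc m / m) * (F u / q u)"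
        using F(2)[OF u] \<eta> q0 by (intro diff_left_mono mult_left_mono divide_right_mono) auto
      also have "\<dots> = (1 / q u) ^ Suc m * (1 - real (Suc m) * X u)"
        using q0 m by (simp add: F_def X_def power_divide field_simps del: of_nat_Suc)
      also have "\<dots> \<le> (1 / q u) ^ Suc m * (1 / (1 + X u)) ^ Suc m"
        using q0 by (intro mult_left_mono inverse_power_lower X u) auto
      also have "\<dots> = (1 / p u) ^ Suc m"
        by (simp add: pX[OF u] power_divide power_mult_distrib del: power_Suc)
      finally have "((1 / q u) ^ Suc m - \<eta> * (Suc m / m) * ((quartic (real m) u + 3 * \<delta>) / q u)) * sine w ^ Suc m
        \<le> (1 / p u) ^ Suc m * sine w ^ Suc m"
        using sine_pos[of w] by (intro mult_right_mono) auto
      then show ?thesis by (simp add: u_def left_diff_distrib mult.assoc del: power_Suc)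
    qed
    have q20: "q u \<ge> 3 / 20" if "\<bar>u\<bar> \<le> 1" for u using q[OF that] by simp
    note intq = int[where r = q, OF q_cont q20] and intp = int[where r = p, OF p_cont p]
    have "J q < J q - \<eta> * (Suc m / m) * I"
    proof -
      have "\<eta> * (Suc m / m) > 0" using \<eta> m by simp
      from mult_pos_neg[OF this I] show ?thesis by linarith
    qed
    also have "\<dots> = (LBINT w. (1 / q (cosine w)) ^ Suc m * sine w ^ Suc m 
        - \<eta> * (Suc m / m) * ((quartic (real m) (cosine w) + 3 * \<delta>) / q (cosine w) * sine w ^ Suc m))"
      unfolding J_def I_def
      by (simp only: Bochner_Integration.integral_diff[OF intq integrable_mult_right[OF intI]] integral_mult_right_zero)
    also have "\<dots> \<le> J p"
      unfolding J_def
      by (rule integral_mono[OF Bochner_Integration.integrable_diff[OF intq integrable_mult_right[OF intI]] intp pw])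
    finally have "J q < J p" .
    moreover have "J q \<ge> 0" unfolding J_def using q20[OF abs_cosine_le_1] sine_pos 
      by (intro Bochner_Integration.integral_nonneg mult_nonneg_nonneg zero_le_power) (auto intro: less_imp_le order_trans[of 0 "3 / 20"])
    ultimately show ?thesis using K by (simp add: J[where r = q, OF q_cont q20] J[where r = p, OF p_cont p] ennreal_less_iff)
  qed
  show thesis using that[OF p_gauge q_gauge sections volume] .
qed

section \<open>From Lebesgue measure to the log-concave measure\<close>

lemma subspace_lborel_eq_span_lborel:
  fixes \<xi> :: "'a::euclidean_space"
  assumes \<xi>: "\<xi> \<noteq> 0"
  obtains B where "orthonormal_set B" "Suc (card B) = DIM('a)" "span B = hyperplane_perp \<xi>"
    "subspace_lborel (hyperplane_perp \<xi>) = span_lborel B"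
proof -
  \<comment> \<open>\<open>B\<close> is the very basis selected inside
    \<open>subspace_lborel\<close>, so the two measures agree by definition.\<close>
  define B where "B = (SOME B. orthonormal_basis (hyperplane_perp \<xi>) B)"
  have "subspace (hyperplane_perp \<xi>)"
    unfolding hyperplane_perp_def by (rule subspace_hyperplane)
  then have "\<exists>B. orthonormal_basis (hyperplane_perp \<xi>) B"
    unfolding orthonormal_basis_def by (metis orthonormal_basis_subspace)
  then have B: "orthonormal_basis (hyperplane_perp \<xi>) B"
    unfolding B_def by (rule someI_ex)
  then interpret orthonormal_set B
    by unfold_locales (auto simp: orthonormal_basis_def)
  have span: "span B = hyperplane_perp \<xi>" using B by (simp add: orthonormal_basis_def)
  have "0 \<notin> B" using unit by force
  then have "independent B" by (intro pairwise_orthogonal_independent orthogonal)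
  then have "card B = dim (span B)" by (simp add: dim_eq_card_independent)
  also have "\<dots> = DIM('a) - 1" using \<xi> by (simp add: span hyperplane_perp_def dim_hyperplane)
  finally have "Suc (card B) = DIM('a)" by simp
  moreover have "subspace_lborel (hyperplane_perp \<xi>) = span_lborel B"
    by (simp add: subspace_lborel_def span_lborel_def B_def Let_def)
  ultimately show thesis using that span orthonormal_set_axioms by blast
qed

lemma (in body_gauge) emeasure_span_lborel_le:
  assumes "finite B" "r > 0"
  shows "emeasure (span_lborel B) {x. N x \<le> r} = ennreal (r ^ card B) * emeasure (span_lborel B) {x. N x \<le> 1}"
proof -
  have "emeasure (span_lborel B) {x. N x \<le> r} = (\<integral>\<^sup>+x. indicator {x. N x \<le> r} x \<partial>span_lborel B)" by simp
  also have "\<dots> = ennreal (r ^ card B) * (\<integral>\<^sup>+x. indicator {x. N x \<le> r} (r *\<^sub>R x) \<partial>span_lborel B)"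
    using assms by (intro nn_integral_span_lborel_scale) auto
  also have "(\<lambda>x. indicator {x. N x \<le> r} (r *\<^sub>R x) :: ennreal) = indicator {x. N x \<le> 1}"
    using assms by (auto simp: indicator_def hom)
  finally show ?thesis by simp
qed

theorem theorem3:
  assumes "CARD('n::finite) \<ge> 5"
  shows "\<exists>(K :: (real ^ 'n) set) (L :: (real ^ 'n) set)
            (\<mu> :: (real ^ 'n) measure) (\<phi> :: real \<Rightarrow> real) (f :: real ^ 'n \<Rightarrow> real).
           convex_body K \<and> symmetric_set K \<and> convex_body L \<and> symmetric_set L \<and>
           (\<forall>t\<ge>0. 0 \<le> \<phi> t) \<and> \<not> \<phi> constant_on {0..} \<and>
           mono_on {0..} \<phi> \<and> convex_on {0..} \<phi> \<and>
           f = (\<lambda>x. exp (- \<phi> (minkowski_functional L x))) \<and>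
           f \<in> borel_measurable borel \<and>
           \<mu> = density lborel (\<lambda>x. ennreal (f x)) \<and>
           log_concave_measure \<mu> \<and>
           (\<forall>\<xi>\<in>sphere 0 1. \<forall>r>0.
              section_measure f ((*\<^sub>R) r ` K) \<xi> \<le> section_measure f ((*\<^sub>R) r ` L) \<xi>) \<and>
           emeasure \<mu> K > emeasure \<mu> L"
proof -
  obtain e :: "real ^ 'n" where e: "e \<in> Basis" using nonempty_Basis by blast
  have "DIM(real ^ 'n) \<ge> 5" using assms by simp
  with Busemann_Petty_counterexample[OF e] obtain M N :: "real ^ 'n \<Rightarrow> real" and b c where M: "body_gauge M b" and N: "body_gauge N c"
    and sections: "\<And>B. orthonormal_set B \<Longrightarrow> Suc (card B) = DIM(real ^ 'n) \<Longrightarrow>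
       emeasure (span_lborel B) {x. M x \<le> 1} \<le> emeasure (span_lborel B) {x. N x \<le> 1}"
    and volume: "emeasure lborel {x. N x \<le> 1} < emeasure lborel {x. M x \<le> 1}"
    by metis
  interpret M: body_gauge M b by (rule M)
  interpret N: body_gauge N c by (rule N)
  let ?K = "{x. M x \<le> 1}" and ?L = "{x. N x \<le> 1}"
  have "compact ?K" using M.convex_body by (simp add: convex_body_def)
  then have "bounded (N ` ?K)"
    by (intro compact_imp_bounded compact_continuous_image continuous_on_subset[OF N.continuous]) auto
  then obtain R0 where R0: "\<And>x. x \<in> ?K \<Longrightarrow> \<bar>N x\<bar> \<le> R0" by (auto simp: bounded_iff)
  \<comment> \<open>The truncation is to vanish on both bodies: \<open>N\<close> is at most 1 on
    \<open>?L\<close> and at most \<open>R0\<close> on \<open>?K\<close>.\<close>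
  define R where "R = max 1 R0"
  have R: "R \<ge> 1" "\<And>x. M x \<le> 1 \<Longrightarrow> N x \<le> R" using R0 by (force simp: R_def)+
  define \<phi> where "\<phi> t = max 0 (t - R)" for t :: real
  define f where "f x = exp (- \<phi> (N x))" for x
  have f_meas [measurable]: "f \<in> borel_measurable borel" unfolding f_def \<phi>_def by measurable
  define \<mu> where "\<mu> = density lborel (\<lambda>x. ennreal (f x))"
  have "\<not> \<phi> constant_on {0..}"
  proof
    assume "\<phi> constant_on {0..}"
    then obtain z where "\<And>t. t \<ge> 0 \<Longrightarrow> \<phi> t = z" by (auto simp: constant_on_def)
    from this[of R] this[of "R + 1"] R(1) show False by (simp add: \<phi>_def)
  qed
  moreover have "mono_on {0..} \<phi>" by (auto intro!: mono_onI simp: \<phi>_def)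
  moreover have "convex_on {0..} \<phi>"
    unfolding \<phi>_def by (rule convex_on_subset[OF convex_on_truncation]) auto
  moreover have "f = (\<lambda>x. exp (- \<phi> (minkowski_functional ?L x)))"
    by (auto simp: f_def N.minkowski_functional)
  moreover have "log_concave_measure \<mu>"
    unfolding log_concave_measure_def \<mu>_def using f_meas N.log_concave_truncation[of R]
    by (intro exI[of _ f]) (auto simp: f_def[abs_def] \<phi>_def)
  moreover have "section_measure f ((*\<^sub>R) r ` ?K) \<xi> \<le> section_measure f ((*\<^sub>R) r ` ?L) \<xi>"
    if \<xi>: "\<xi> \<in> sphere 0 1" and r: "r > 0" for \<xi> r
  proof -
    have "\<xi> \<noteq> 0" using \<xi> by auto
    then obtain B where B: "orthonormal_set B" and card: "Suc (card B) = DIM(real ^ 'n)"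
      and span: "span B = hyperplane_perp \<xi>"
      and lborel_eq: "subspace_lborel (hyperplane_perp \<xi>) = span_lborel B"
      by (rule subspace_lborel_eq_span_lborel)
    interpret orthonormal_set B by (rule B)
    have section_eq: "section_measure f A \<xi> = (\<integral>\<^sup>+x\<in>A. ennreal (f x) \<partial>span_lborel B)" for A
      unfolding section_measure_def lborel_eq
      by (rule nn_integral_cong_AE, use AE_span in eventually_elim) (auto simp: span indicator_def)
    show ?thesis
      unfolding section_eq M.scaleR_image[OF r] N.scaleR_image[OF r]
    \<comment> \<open>\<open>f\<close> is a nonincreasing function of \<open>N\<close>, so the
      density favours \<open>{x. N x \<le> r}\<close>, with its value at \<open>N x = r\<close> as
      threshold. By homogeneity the dilates reduce to the case \<open>r = 1\<close>.\<close>
    proof (rule nn_integral_superlevel_mono)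
      show "emeasure (span_lborel B) {x. N x \<le> r} < \<infinity>"
      proof -
        obtain s where "\<And>x. N x \<le> r \<Longrightarrow> norm x \<le> s"
          using N.bounded_le[of r] unfolding bounded_iff by blast
        then have "{x. N x \<le> r} \<subseteq> cball 0 s" by auto
        then have "emeasure (span_lborel B) {x. N x \<le> r} \<le> emeasure (span_lborel B) (cball 0 s)"
          by (intro emeasure_mono) auto
        then show ?thesis using emeasure_cball_finite[of s] by (rule order.strict_trans1)
      qed
      show "emeasure (span_lborel B) {x. M x \<le> r} \<le> emeasure (span_lborel B) {x. N x \<le> r}"
        unfolding M.emeasure_span_lborel_le[OF finite r] N.emeasure_span_lborel_le[OF finite r]
        by (intro mult_left_mono sections B card) auto
      show "ennreal (exp (- \<phi> r)) < \<infinity>" by simp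
      show "ennreal (exp (- \<phi> r)) \<le> ennreal (f x)" if "x \<in> {x. N x \<le> r}" for x
        using that by (intro ennreal_leI) (auto simp: f_def \<phi>_def)
      show "ennreal (f x) \<le> ennreal (exp (- \<phi> r))" if "x \<notin> {x. N x \<le> r}" for x
        using that by (intro ennreal_leI) (auto simp: f_def \<phi>_def)
    qed auto
  qed
  moreover have "emeasure \<mu> ?L < emeasure \<mu> ?K"
  proof -
    \<comment> \<open>\<open>f\<close> is 1 where \<open>N x \<le> R\<close>, so
      \<open>\<mu>\<close> gives both bodies their Lebesgue measure.\<close>
    have "emeasure \<mu> A = emeasure lborel A" if "A \<in> sets borel" "\<And>x. x \<in> A \<Longrightarrow> N x \<le> R" for A
    proof -
      have "emeasure \<mu> A = (\<integral>\<^sup>+x. ennreal (f x) * indicator A x \<partial>lborel)"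
        unfolding \<mu>_def using that by (intro emeasure_density) auto
      also have "\<dots> = (\<integral>\<^sup>+x. indicator A x \<partial>lborel)"
        using that(2) by (intro nn_integral_cong) (auto simp: f_def \<phi>_def indicator_def)
      finally show ?thesis using that(1) by simp
    qed
    from this[of ?L] this[of ?K] show ?thesis using volume R by auto
  qed
  ultimately show ?thesis
    using M.convex_body M.symmetric N.convex_body N.symmetric f_meas
    by (intro exI[of _ ?K] exI[of _ ?L] exI[of _ \<mu>] exI[of _ \<phi>] exI[of _ f]) (auto simp: \<mu>_def \<phi>_def)
qed

end
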